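(* Let $I$ be a totally ordered set with a smallest element and let $A$ be a Banach algebra with $\phi\in\Delta(A)$ (that is, $A$ admits a character $\phi$). Then $UP(I,A)$ is strong pseudo-amenable if and only if $A$ is strong pseudo-amenable and $|I|=1$.
   Context: $\Delta(A)$ is the set of characters of $A$, i.e. non-zero multiplicative linear functionals $A\to\mathbb{C}$. $UP(I,A)$ is the Banach algebra of $I\times I$ upper triangular matrices $(a_{i,j})_{i,j\in I}$ with entries in $A$ ($a_{i,j}=0$ whenever $i>j$) and finite norm $\sum_{i,j}\|a_{i,j}\|<\infty$, with the usual matrix operations. Strong pseudo-amenability: for a (complex) Banach algebra $A$, $A\otimes_p A$ is the projective tensor product, a Banach $A$-bimodule via $a\cdot(b\otimes c)=ab\otimes c$, $(b\otimes c)\cdot a=b\otimes ca$; $\pi_A:A\otimes_pA\to A$ is the bounded linear map with $\pi_A(a\otimes b)=ab$. For a Banach $A$-bimodule $X$, $X^*$ is a Banach $A$-bimodule via $(a\cdot f)(x)=f(x\cdot a)$, $(f\cdot a)(x)=f(a\cdot x)$; iterating, $(A\otimes_pA)^{**}$ and $A^{**}$ are Banach $A$-bimodules, and $A\subseteq A^{**}$ canonically. $A$ is strong pseudo-amenable if there is a (not necessarily bounded) net $(m_\alpha)$ in $(A\otimes_pA)^{**}$ such that for every $a\in A$: $a\cdot m_\alpha-m_\alpha\cdot a\to 0$ in norm, $a\,\pi_A^{**}(m_\alpha)=\pi_A^{**}(m_\alpha)\,a$ for all $\alpha$, and $\pi_A^{**}(m_\alpha)\,a\to a$ in norm. *)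

theory Defs
  imports "HOL-Analysis.Analysis" "HOL-Library.Poly_Mapping"
begin

section \<open>Complex normed spaces and complex Banach algebras\<close>

class complex_vector = real_vector +
  fixes scaleC :: "complex \<Rightarrow> 'a \<Rightarrow> 'a" (infixr \<open>*\<^sub>C\<close> 75)
  assumes scaleC_add_right: "c *\<^sub>C (x + y) = c *\<^sub>C x + c *\<^sub>C y"
    and scaleC_add_left: "(c + d) *\<^sub>C x = c *\<^sub>C x + d *\<^sub>C x"
    and scaleC_scaleC: "c *\<^sub>C d *\<^sub>C x = (c * d) *\<^sub>C x"
    and scaleC_of_real: "complex_of_real r *\<^sub>C x = r *\<^sub>R x"

class complex_normed_vector = complex_vector + real_normed_vector +
  assumes norm_scaleC: "norm (c *\<^sub>C x) = cmod c * norm x"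

class cbanach = complex_normed_vector + banach

text \<open>Algebras are not assumed to be unital.\<close>

class complex_banach_algebra = cbanach + real_normed_algebra +
  assumes scaleC_mult_left: "(c *\<^sub>C x) * y = c *\<^sub>C (x * y)"
    and scaleC_mult_right: "x * (c *\<^sub>C y) = c *\<^sub>C (x * y)"

lemma scaleC_one [simp]: "1 *\<^sub>C (x::'a::complex_vector) = x"
  using scaleC_of_real[of 1 x] by simp

lemma scaleC_zero_left [simp]: "0 *\<^sub>C (x::'a::complex_vector) = 0"
  using scaleC_of_real[of 0 x] by simp

lemma scaleC_zero_right [simp]: "c *\<^sub>C (0::'a::complex_vector) = 0"
  using scaleC_add_right[of c 0 0] by simp

lemma scaleC_minus1: "(-1) *\<^sub>C (x::'a::complex_vector) = - x"
  using scaleC_of_real[of "-1" x] by simp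

lemma scaleC_minus_right: "c *\<^sub>C (- x::'a::complex_vector) = - (c *\<^sub>C x)"
  using scaleC_add_right[of c x "-x"] by (simp add: add_eq_0_iff)

lemma scaleC_diff_right: "c *\<^sub>C (x - y::'a::complex_vector) = c *\<^sub>C x - c *\<^sub>C y"
  using scaleC_add_right[of c x "-y"] by (simp add: scaleC_minus_right)

lemma scaleC_sum_right: "c *\<^sub>C (\<Sum>k\<in>S. f k) = (\<Sum>k\<in>S. c *\<^sub>C (f k :: 'a::complex_vector))"
  by (induction S rule: infinite_finite_induct) (auto simp: scaleC_add_right)

instantiation complex :: complex_banach_algebra
begin
definition scaleC_complex :: "complex \<Rightarrow> complex \<Rightarrow> complex"
  where "scaleC_complex c x = c * x"
instance
  by standard (simp_all add: scaleC_complex_def algebra_simps norm_mult scaleR_conv_of_real)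
end

definition clinear :: "('a::complex_vector \<Rightarrow> 'b::complex_vector) \<Rightarrow> bool"
  where "clinear f \<longleftrightarrow> (\<forall>x y. f (x + y) = f x + f y) \<and> (\<forall>c x. f (c *\<^sub>C x) = c *\<^sub>C f x)"

definition bounded_clinear :: "('a::complex_normed_vector \<Rightarrow> 'b::complex_normed_vector) \<Rightarrow> bool"
  where "bounded_clinear f \<longleftrightarrow> clinear f \<and> (\<exists>K. \<forall>x. norm (f x) \<le> norm x * K)"

definition cbilinear :: "('a::complex_vector \<Rightarrow> 'b::complex_vector \<Rightarrow> 'c::complex_vector) \<Rightarrow> bool"
  where "cbilinear B \<longleftrightarrow> (\<forall>x. clinear (B x)) \<and> (\<forall>y. clinear (\<lambda>x. B x y))"

definition bounded_cbilinear ::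
    "('a::complex_normed_vector \<Rightarrow> 'b::complex_normed_vector \<Rightarrow> 'c::complex_normed_vector) \<Rightarrow> bool"
  where "bounded_cbilinear B \<longleftrightarrow>
    cbilinear B \<and> (\<exists>K. \<forall>x y. norm (B x y) \<le> norm x * norm y * K)"

definition characters :: "('a::complex_banach_algebra \<Rightarrow> complex) set"
  where "characters = {\<phi>. clinear \<phi> \<and> (\<forall>x y. \<phi> (x * y) = \<phi> x * \<phi> y) \<and> (\<exists>x. \<phi> x \<noteq> 0)}"

lemma clinear_add: "clinear f \<Longrightarrow> f (x + y) = f x + f y"
  and clinear_scaleC: "clinear f \<Longrightarrow> f (c *\<^sub>C x) = c *\<^sub>C f x"
  by (auto simp: clinear_def)

lemma clinear_zero: "clinear f \<Longrightarrow> f 0 = 0"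
  using clinear_scaleC[of f 0 0] by simp

lemma clinear_minus: "clinear f \<Longrightarrow> f (- x) = - f x"
  using clinear_scaleC[of f "-1" x] by (simp add: scaleC_minus1)

lemma clinear_diff: "clinear f \<Longrightarrow> f (x - y) = f x - f y"
  using clinear_add[of f x "- y"] by (simp add: clinear_minus)

lemma clinear_scaleR: "clinear f \<Longrightarrow> f (r *\<^sub>R x) = r *\<^sub>R f x"
  using clinear_scaleC[of f "of_real r" x] by (simp add: scaleC_of_real)

lemma clinear_sum_list: "clinear f \<Longrightarrow> f (\<Sum>x\<leftarrow>xs. g x) = (\<Sum>x\<leftarrow>xs. f (g x))"
  by (induction xs) (auto simp: clinear_add clinear_zero)

lemma bounded_clinear_clinear: "bounded_clinear f \<Longrightarrow> clinear f"
  by (simp add: bounded_clinear_def)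

lemma bounded_clinear_bounded_linear:
  assumes "bounded_clinear f" shows "bounded_linear f"
  using assms unfolding bounded_clinear_def
  by (auto intro!: bounded_linear_intro simp: clinear_add clinear_scaleR)

lemma bounded_clinear_bound:
  assumes "bounded_clinear f" obtains K where "K \<ge> 0" "\<And>x. norm (f x) \<le> norm x * K"
proof -
  obtain K where K: "\<And>x. norm (f x) \<le> norm x * K"
    using assms by (auto simp: bounded_clinear_def)
  have "norm (f x) \<le> norm x * \<bar>K\<bar>" for x
    using K[of x] by (meson abs_ge_self mult_left_mono norm_ge_zero order_trans)
  then show thesis using that[of "\<bar>K\<bar>"] by auto
qed

lemma bounded_cbilinear_bound:
  assumes "bounded_cbilinear B"
  obtains K where "K \<ge> 0" "\<And>x y. norm (B x y) \<le> norm x * norm y * K"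
proof -
  obtain K where K: "\<And>x y. norm (B x y) \<le> norm x * norm y * K"
    using assms by (auto simp: bounded_cbilinear_def)
  have "norm (B x y) \<le> norm x * norm y * \<bar>K\<bar>" for x y
    using K[of x y] by (meson abs_ge_self mult_left_mono norm_ge_zero mult_nonneg_nonneg order_trans)
  then show thesis using that[of "\<bar>K\<bar>"] by auto
qed

lemma bounded_clinearI:
  assumes "\<And>x y. f (x + y) = f x + f y" "\<And>c x. f (c *\<^sub>C x) = c *\<^sub>C f x"
    "\<And>x. norm (f x) \<le> norm x * K"
  shows "bounded_clinear f"
  using assms by (auto simp: bounded_clinear_def clinear_def)

lemma bounded_clinear_compose:
  assumes "bounded_clinear f" "bounded_clinear g"
  shows "bounded_clinear (\<lambda>x. f (g x))"
proof -
  obtain K L where K: "K \<ge> 0" "\<And>x. norm (f x) \<le> norm x * K" and L: "\<And>x. norm (g x) \<le> norm x * L"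
    using assms by (meson bounded_clinear_bound)
  have "norm (f (g x)) \<le> norm x * (L * K)" for x
    using order_trans[OF K(2) mult_right_mono[OF L K(1)]] by (simp add: mult.assoc)
  then show ?thesis
    using assms by (intro bounded_clinearI) (auto simp: bounded_clinear_def clinear_def)
qed


section \<open>The dual space\<close>

typedef (overloaded) 'a cdual = "{f :: 'a::complex_normed_vector \<Rightarrow> complex. bounded_clinear f}"
  morphisms cdual_apply Abs_cdual
  by (rule exI[of _ "\<lambda>_. 0"]) (auto simp: bounded_clinear_def clinear_def intro!: exI[of _ 0])

setup_lifting type_definition_cdual

lemma bounded_clinear_add:
  assumes f: "bounded_clinear f" and g: "bounded_clinear g"
  shows "bounded_clinear (\<lambda>x. f x + g x)"
proof -
  obtain K L where K: "\<And>x. norm (f x) \<le> norm x * K" and L: "\<And>x. norm (g x) \<le> norm x * L"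
    using f g by (meson bounded_clinear_bound)
  have "norm (f x + g x) \<le> norm x * (K + L)" for x
    using K[of x] L[of x] by (auto simp: distrib_left intro: norm_triangle_le add_mono)
  then show ?thesis
    using f g by (intro bounded_clinearI)
      (auto simp: bounded_clinear_def clinear_def scaleC_add_right)
qed

lemma bounded_clinear_scale:
  assumes f: "bounded_clinear f"
  shows "bounded_clinear (\<lambda>x. d *\<^sub>C f x)"
proof -
  obtain K where K: "\<And>x. norm (f x) \<le> norm x * K"
    using f by (meson bounded_clinear_bound)
  have "norm (d *\<^sub>C f x) \<le> norm x * (cmod d * K)" for x
    using mult_left_mono[OF K[of x], of "cmod d"] by (simp add: norm_scaleC mult.left_commute)
  then show ?thesis
    using f by (intro bounded_clinearI)
      (auto simp: bounded_clinear_def clinear_def scaleC_add_right scaleC_scaleC mult.commute[of d])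
qed

lemma bounded_clinear_zero: "bounded_clinear (\<lambda>_. 0)"
  by (auto intro: bounded_clinearI[where K=0])

lemma bounded_clinear_cdual_apply: "bounded_clinear (cdual_apply f)"
  using cdual_apply by auto

lemma cdual_eqI: "(\<And>x. cdual_apply f x = cdual_apply g x) \<Longrightarrow> f = g"
  by (metis cdual_apply_inject ext)

instantiation cdual :: (complex_normed_vector) complex_normed_vector
begin

lift_definition zero_cdual :: "'a cdual" is "\<lambda>_. 0"
  by (rule bounded_clinear_zero)
lift_definition plus_cdual :: "'a cdual \<Rightarrow> 'a cdual \<Rightarrow> 'a cdual" is "\<lambda>f g x. f x + g x"
  by (rule bounded_clinear_add)
lift_definition scaleC_cdual :: "complex \<Rightarrow> 'a cdual \<Rightarrow> 'a cdual" is "\<lambda>c f x. c * f x"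
  by (rule bounded_clinear_scale[where 'b = complex, unfolded scaleC_complex_def])
lift_definition uminus_cdual :: "'a cdual \<Rightarrow> 'a cdual" is "\<lambda>f x. - f x"
  by (rule bounded_clinear_scale[where d = "-1" and 'b = complex, unfolded scaleC_minus1])
lift_definition norm_cdual :: "'a cdual \<Rightarrow> real" is onorm .
definition minus_cdual :: "'a cdual \<Rightarrow> 'a cdual \<Rightarrow> 'a cdual" where "f - g = f + - g" for f g :: "'a cdual"
definition scaleR_cdual :: "real \<Rightarrow> 'a cdual \<Rightarrow> 'a cdual" where "scaleR_cdual r f = complex_of_real r *\<^sub>C f"
definition dist_cdual :: "'a cdual \<Rightarrow> 'a cdual \<Rightarrow> real" where "dist_cdual f g = norm (f - g)"
definition sgn_cdual :: "'a cdual \<Rightarrow> 'a cdual" where "sgn_cdual f = scaleR (inverse (norm f)) f"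
definition uniformity_cdual :: "('a cdual \<times> 'a cdual) filter"
  where "uniformity_cdual = (INF e\<in>{0 <..}. principal {(f, g). dist f g < e})"
definition open_cdual :: "'a cdual set \<Rightarrow> bool"
  where "open_cdual S = (\<forall>x\<in>S. \<forall>\<^sub>F (x', y) in uniformity. x' = x \<longrightarrow> y \<in> S)"

instance
proof
  fix f g h :: "'a cdual" and c d :: complex and r s :: real
  note ops = zero_cdual.rep_eq plus_cdual.rep_eq uminus_cdual.rep_eq scaleC_cdual.rep_eq
  show "f + g + h = f + (g + h)" "f + g = g + f" "0 + f = f" "- f + f = 0"
    "c *\<^sub>C (f + g) = c *\<^sub>C f + c *\<^sub>C g" "(c + d) *\<^sub>C f = c *\<^sub>C f + d *\<^sub>C f"
    "c *\<^sub>C d *\<^sub>C f = (c * d) *\<^sub>C f"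
    by (rule cdual_eqI; simp add: ops algebra_simps)+
  show "f - g = f + - g" by (rule minus_cdual_def)
  show "complex_of_real r *\<^sub>C f = r *\<^sub>R f" by (rule scaleR_cdual_def[symmetric])
  show "r *\<^sub>R (f + g) = r *\<^sub>R f + r *\<^sub>R g" "(r + s) *\<^sub>R f = r *\<^sub>R f + s *\<^sub>R f"
    "r *\<^sub>R s *\<^sub>R f = (r * s) *\<^sub>R f" "1 *\<^sub>R f = f"
    by (rule cdual_eqI; simp add: ops scaleR_cdual_def algebra_simps)+
  show "dist f g = norm (f - g)" by (rule dist_cdual_def)
  show "sgn f = scaleR (inverse (norm f)) f" by (rule sgn_cdual_def)
  show "uniformity = (INF e\<in>{0<..}. principal {(f, g :: 'a cdual). dist f g < e})"
    by (rule uniformity_cdual_def)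
  show "open S = (\<forall>x\<in>S. \<forall>\<^sub>F (x', y) in uniformity. x' = x \<longrightarrow> y \<in> S)" for S :: "'a cdual set"
    by (rule open_cdual_def)
  show "norm (f + g) \<le> norm f + norm g"
    by transfer (auto intro: onorm_triangle bounded_clinear_bounded_linear)
  show "(norm f = 0) = (f = 0)"
    by transfer (auto simp: onorm_eq_0 bounded_clinear_bounded_linear)
  have scC: "norm (c *\<^sub>C f) \<le> cmod c * norm f" for c and f :: "'a cdual"
  proof (transfer, goal_cases)
    case (1 c f)
    have "norm (c * f x) \<le> cmod c * onorm f * norm x" for x
      using onorm[OF bounded_clinear_bounded_linear[OF 1], of x]
      by (simp add: norm_mult mult.assoc mult_left_mono)
    moreover have "0 \<le> cmod c * onorm f"
      by (intro mult_nonneg_nonneg norm_ge_zero onorm_pos_le bounded_clinear_bounded_linear 1)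
    ultimately show ?case by (intro onorm_bound)
  qed
  have norm_C: "norm (c *\<^sub>C f) = cmod c * norm f" for c and f :: "'a cdual"
  proof (rule antisym[OF scC])
    have "norm f \<le> cmod (inverse c) * norm (c *\<^sub>C f)" if "c \<noteq> 0"
    proof -
      have "inverse c *\<^sub>C c *\<^sub>C f = f" using that by (intro cdual_eqI) (simp add: ops)
      then show ?thesis using scC[of "inverse c" "c *\<^sub>C f"] by simp
    qed
    moreover have "0 \<le> norm (c *\<^sub>C f)"
      unfolding norm_cdual.rep_eq
      by (intro onorm_pos_le bounded_clinear_bounded_linear bounded_clinear_cdual_apply)
    ultimately show "cmod c * norm f \<le> norm (c *\<^sub>C f)"
      by (cases "c = 0") (auto simp: norm_inverse norm_divide field_simps)
  qed
  show "norm (c *\<^sub>C f) = cmod c * norm f" by (rule norm_C)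
  show "norm (r *\<^sub>R f) = \<bar>r\<bar> * norm f" by (simp add: scaleR_cdual_def norm_C)
qed

end

lemma norm_cdual_apply: "norm (cdual_apply f x) \<le> norm f * norm x"
  by transfer (simp add: onorm bounded_clinear_bounded_linear)

lemma norm_cdual_le: "0 \<le> K \<Longrightarrow> (\<And>x. norm (cdual_apply f x) \<le> K * norm x) \<Longrightarrow> norm f \<le> K"
  unfolding norm_cdual.rep_eq by (rule onorm_bound)

text \<open>\<open>dual_map T\<close> is the transpose \<open>T\<^sup>*\<close> of a bounded operator; iterate it for \<open>T\<^sup>*\<^sup>*\<close>.
  It is a total function, with the dummy value \<open>0\<close> if \<open>T\<close> is not bounded and linear.\<close>

lift_definition dual_map ::
    "('a::complex_normed_vector \<Rightarrow> 'b::complex_normed_vector) \<Rightarrow> 'b cdual \<Rightarrow> 'a cdual"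
  is "\<lambda>T f x. if bounded_clinear T then f (T x) else 0"
  subgoal for T f by (cases "bounded_clinear T") (auto simp: bounded_clinear_zero intro: bounded_clinear_compose)
  done

lemma cdual_apply_dual_map:
  "bounded_clinear T \<Longrightarrow> cdual_apply (dual_map T f) x = cdual_apply f (T x)"
  by (simp add: dual_map.rep_eq)

lift_definition canonical_embedding :: "'a::complex_normed_vector \<Rightarrow> 'a cdual cdual"
  is "\<lambda>x f. cdual_apply f x"
  subgoal for x
    by (rule bounded_clinearI[where K="norm x"])
      (auto simp: plus_cdual.rep_eq scaleC_cdual.rep_eq scaleC_complex_def norm_cdual_apply)
  done


section \<open>The algebraic tensor product\<close>

text \<open>
  The free complex vector space on \<open>A \<times> B\<close> is the type of finitely supported functions; it is
  divided by the linear span of the usual bilinearity relations.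
\<close>

definition free_scale :: "complex \<Rightarrow> ('k \<Rightarrow>\<^sub>0 complex) \<Rightarrow> ('k \<Rightarrow>\<^sub>0 complex)"
  where "free_scale c = Poly_Mapping.map (\<lambda>z. c * z)"

abbreviation free_gen :: "'a \<Rightarrow> 'b \<Rightarrow> ('a \<times> 'b \<Rightarrow>\<^sub>0 complex)"
  where "free_gen x y \<equiv> Poly_Mapping.single (x, y) 1"

inductive bilinear_null :: "('a::complex_vector \<times> 'b::complex_vector \<Rightarrow>\<^sub>0 complex) \<Rightarrow> bool" where
  null_zero: "bilinear_null 0"
| null_add: "bilinear_null u \<Longrightarrow> bilinear_null v \<Longrightarrow> bilinear_null (u + v)"
| null_scale: "bilinear_null u \<Longrightarrow> bilinear_null (free_scale c u)"
| null_add_left: "bilinear_null (free_gen (x + x') y - free_gen x y - free_gen x' y)"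
| null_add_right: "bilinear_null (free_gen x (y + y') - free_gen x y - free_gen x y')"
| null_scale_left: "bilinear_null (free_gen (c *\<^sub>C x) y - free_scale c (free_gen x y))"
| null_scale_right: "bilinear_null (free_gen x (c *\<^sub>C y) - free_scale c (free_gen x y))"

lemma lookup_free_scale [simp]: "Poly_Mapping.lookup (free_scale c u) k = c * Poly_Mapping.lookup u k"
  by (simp add: free_scale_def Poly_Mapping.map.rep_eq when_def)

lemma bilinear_null_minus: "bilinear_null u \<Longrightarrow> bilinear_null (- u)"
proof -
  have "- u = free_scale (- 1) u" by (rule poly_mapping_eqI) simp
  then show "bilinear_null u \<Longrightarrow> bilinear_null (- u)" by (simp add: null_scale)
qed

quotient_type (overloaded) ('a, 'b) atensor =
    "'a::complex_vector \<times> 'b::complex_vector \<Rightarrow>\<^sub>0 complex" / "\<lambda>u v. bilinear_null (u - v)"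
proof (rule equivpI)
  show "reflp (\<lambda>u v :: 'a \<times> 'b \<Rightarrow>\<^sub>0 complex. bilinear_null (u - v))"
    by (auto simp: reflp_def null_zero)
  show "symp (\<lambda>u v :: 'a \<times> 'b \<Rightarrow>\<^sub>0 complex. bilinear_null (u - v))"
    by (rule sympI, drule bilinear_null_minus) simp
  show "transp (\<lambda>u v :: 'a \<times> 'b \<Rightarrow>\<^sub>0 complex. bilinear_null (u - v))"
    by (rule transpI, drule (1) null_add) simp
qed

instantiation atensor :: (complex_vector, complex_vector) complex_vector
begin

lift_definition zero_atensor :: "('a, 'b) atensor" is 0 .
lift_definition plus_atensor :: "('a, 'b) atensor \<Rightarrow> ('a, 'b) atensor \<Rightarrow> ('a, 'b) atensor" is "(+)"
  by (simp only: add_diff_add null_add)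
lift_definition uminus_atensor :: "('a, 'b) atensor \<Rightarrow> ('a, 'b) atensor" is uminus
  by (simp only: minus_diff_minus bilinear_null_minus)
lift_definition scaleC_atensor :: "complex \<Rightarrow> ('a, 'b) atensor \<Rightarrow> ('a, 'b) atensor" is free_scale
proof -
  fix c and u v :: "'a \<times> 'b \<Rightarrow>\<^sub>0 complex" assume "bilinear_null (u - v)"
  moreover have "free_scale c (u - v) = free_scale c u - free_scale c v"
    by (rule poly_mapping_eqI) (simp add: lookup_minus algebra_simps)
  ultimately show "bilinear_null (free_scale c u - free_scale c v)" by (metis null_scale)
qed
definition minus_atensor :: "('a, 'b) atensor \<Rightarrow> ('a, 'b) atensor \<Rightarrow> ('a, 'b) atensor"
  where "minus_atensor u v = u + - v"
definition scaleR_atensor :: "real \<Rightarrow> ('a, 'b) atensor \<Rightarrow> ('a, 'b) atensor"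
  where "scaleR_atensor r u = complex_of_real r *\<^sub>C u"

instance
proof
  fix u v w :: "('a, 'b) atensor" and c d :: complex and r s :: real
  have eq: "bilinear_null (x - y)" if "x = y" for x y :: "'a \<times> 'b \<Rightarrow>\<^sub>0 complex"
    using that by (simp add: null_zero)
  show "u + v + w = u + (v + w)" by transfer (simp add: null_zero add.assoc)
  show "u + v = v + u" by transfer (simp add: null_zero add.commute)
  show "0 + u = u" by transfer (simp add: null_zero)
  show "- u + u = 0" by transfer (simp add: null_zero)
  show "u - v = u + - v" by (rule minus_atensor_def)
  show addC: "c *\<^sub>C (u + v) = c *\<^sub>C u + c *\<^sub>C v" for c
    by transfer (intro eq poly_mapping_eqI, simp add: lookup_add algebra_simps)
  show addC': "(c + d) *\<^sub>C u = c *\<^sub>C u + d *\<^sub>C u" for c d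
    by transfer (intro eq poly_mapping_eqI, simp add: lookup_add algebra_simps)
  show CC: "c *\<^sub>C d *\<^sub>C u = (c * d) *\<^sub>C u" for c d
    by transfer (intro eq poly_mapping_eqI, simp add: lookup_add algebra_simps)
  have C1: "1 *\<^sub>C u = u"
    by transfer (intro eq poly_mapping_eqI, simp add: lookup_add algebra_simps)
  show "complex_of_real r *\<^sub>C u = r *\<^sub>R u" by (rule scaleR_atensor_def[symmetric])
  show "r *\<^sub>R (u + v) = r *\<^sub>R u + r *\<^sub>R v" "(r + s) *\<^sub>R u = r *\<^sub>R u + s *\<^sub>R u"
    "r *\<^sub>R s *\<^sub>R u = (r * s) *\<^sub>R u" "1 *\<^sub>R u = u"
    by (simp_all add: scaleR_atensor_def addC addC' CC C1)
qed

end

lift_definition atensor_of :: "'a::complex_vector \<Rightarrow> 'b::complex_vector \<Rightarrow> ('a, 'b) atensor"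
    (infixl \<open>\<otimes>\<^sub>a\<close> 70)
  is free_gen .

lemma cbilinear_atensor_of: "cbilinear (\<otimes>\<^sub>a)"
  unfolding cbilinear_def clinear_def
proof (intro conjI allI)
  fix x x' :: 'a and y y' :: 'b and c
  show "x \<otimes>\<^sub>a (y + y') = x \<otimes>\<^sub>a y + x \<otimes>\<^sub>a y'" "(x + x') \<otimes>\<^sub>a y = x \<otimes>\<^sub>a y + x' \<otimes>\<^sub>a y"
    by (transfer, simp only: diff_diff_eq[symmetric], intro null_add_right null_add_left)+
  show "x \<otimes>\<^sub>a (c *\<^sub>C y) = c *\<^sub>C (x \<otimes>\<^sub>a y)" "(c *\<^sub>C x) \<otimes>\<^sub>a y = c *\<^sub>C (x \<otimes>\<^sub>a y)"
    by (transfer, intro null_scale_left null_scale_right)+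
qed

lemma atensor_of_simps:
  "(x + x') \<otimes>\<^sub>a y = x \<otimes>\<^sub>a y + x' \<otimes>\<^sub>a y" "x \<otimes>\<^sub>a (y + y') = x \<otimes>\<^sub>a y + x \<otimes>\<^sub>a y'"
  "(c *\<^sub>C x) \<otimes>\<^sub>a y = c *\<^sub>C (x \<otimes>\<^sub>a y)" "x \<otimes>\<^sub>a (c *\<^sub>C y) = c *\<^sub>C (x \<otimes>\<^sub>a y)"
  using cbilinear_atensor_of unfolding cbilinear_def clinear_def by blast+

definition free_lift ::
    "('a \<Rightarrow> 'b \<Rightarrow> 'c::complex_vector) \<Rightarrow> ('a \<times> 'b \<Rightarrow>\<^sub>0 complex) \<Rightarrow> 'c"
  where "free_lift B u = (\<Sum>(x, y)\<in>Poly_Mapping.keys u. Poly_Mapping.lookup u (x, y) *\<^sub>C B x y)"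

lemma free_lift_superset:
  assumes "finite S" "Poly_Mapping.keys u \<subseteq> S"
  shows "free_lift B u = (\<Sum>(x, y)\<in>S. Poly_Mapping.lookup u (x, y) *\<^sub>C B x y)"
  unfolding free_lift_def using assms
  by (intro sum.mono_neutral_left) (auto simp: in_keys_iff)

lemma free_lift_add: "free_lift B (u + v) = free_lift B u + free_lift B v"
proof -
  let ?S = "Poly_Mapping.keys u \<union> Poly_Mapping.keys v"
  have "free_lift B w = (\<Sum>(x, y)\<in>?S. Poly_Mapping.lookup w (x, y) *\<^sub>C B x y)"
    if "w \<in> {u, v, u + v}" for w
    using that Poly_Mapping.keys_add[of u v] by (intro free_lift_superset) auto
  then show ?thesis
    by (simp add: lookup_add scaleC_add_left case_prod_unfold flip: sum.distrib)
qed

lemma free_lift_scale: "free_lift B (free_scale c u) = c *\<^sub>C free_lift B u"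
proof -
  have "free_lift B (free_scale c u) =
      (\<Sum>(x, y)\<in>Poly_Mapping.keys u. Poly_Mapping.lookup (free_scale c u) (x, y) *\<^sub>C B x y)"
    by (rule free_lift_superset) (auto simp: in_keys_iff)
  then show ?thesis
    by (simp add: free_lift_def scaleC_sum_right case_prod_unfold scaleC_scaleC)
qed

lemma free_lift_diff: "free_lift B (u - v) = free_lift B u - free_lift B v"
  using free_lift_add[of B "u - v" v] by simp

lemma free_lift_gen: "free_lift B (free_gen x y) = B x y"
  by (simp add: free_lift_def)

lemma free_lift_null:
  assumes "cbilinear B" "bilinear_null u" shows "free_lift B u = 0"
  using assms(2)
proof induction
  case null_zero
  then show ?case by (simp add: free_lift_def)
qed (use assms(1) in \<open>auto simp: free_lift_add free_lift_scale free_lift_diff free_lift_gen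
        cbilinear_def clinear_def\<close>)

lift_definition atensor_lift ::
    "('a::complex_vector \<Rightarrow> 'b::complex_vector \<Rightarrow> 'c::complex_vector) \<Rightarrow> ('a, 'b) atensor \<Rightarrow> 'c"
  is "\<lambda>B u. if cbilinear B then free_lift B u else 0"
  using free_lift_null by (force simp: free_lift_diff)

lemma atensor_lift_of: "cbilinear B \<Longrightarrow> atensor_lift B (x \<otimes>\<^sub>a y) = B x y"
  by transfer (simp add: free_lift_gen)

lemma clinear_atensor_lift: "clinear (atensor_lift B)"
  unfolding clinear_def
proof (intro conjI allI)
  fix u v :: "('a, 'b) atensor" and c
  show "atensor_lift B (u + v) = atensor_lift B u + atensor_lift B v"
    by transfer (simp add: free_lift_add)
  show "atensor_lift B (c *\<^sub>C u) = c *\<^sub>C atensor_lift B u"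
    by transfer (simp add: free_lift_scale)
qed

lemma atensor_representation:
  obtains xs where "u = (\<Sum>(x, y)\<leftarrow>xs. x \<otimes>\<^sub>a y)"
proof -
  have "\<exists>xs. v = (\<Sum>(x, y)\<leftarrow>xs. x \<otimes>\<^sub>a y)" for v :: "('a, 'b) atensor"
  proof (induction v rule: atensor.abs_induct)
    case (1 p)
    show ?case
    proof (induction p rule: update_induct)
      case const
      show ?case by (intro exI[of _ "[]"]) (simp flip: zero_atensor.abs_eq)
    next
      case (update p k c)
      obtain x y where k: "k = (x, y)" by (cases k)
      have "abs_atensor (Poly_Mapping.single k c) = c *\<^sub>C (x \<otimes>\<^sub>a y)"
      proof -
        have "Poly_Mapping.single (x, y) c = free_scale c (free_gen x y)"
          by (rule poly_mapping_eqI) (simp add: lookup_single when_def)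
        then show ?thesis unfolding k by transfer (simp add: null_zero)
      qed
      also have "\<dots> = (c *\<^sub>C x) \<otimes>\<^sub>a y"
        by (simp add: atensor_of_simps(3))
      finally have single: "abs_atensor (Poly_Mapping.single k c) = (c *\<^sub>C x) \<otimes>\<^sub>a y" .
      obtain xs where xs: "abs_atensor p = (\<Sum>(x, y)\<leftarrow>xs. x \<otimes>\<^sub>a y)" using update by blast
      have "Poly_Mapping.update k c p = Poly_Mapping.single k c + p"
        using update(1) by (intro poly_mapping_eqI)
          (auto simp: lookup_update lookup_add lookup_single when_def in_keys_iff)
      then have "abs_atensor (Poly_Mapping.update k c p) = (\<Sum>(x, y)\<leftarrow>(c *\<^sub>C x, y) # xs. x \<otimes>\<^sub>a y)"
        by (simp add: single xs flip: plus_atensor.abs_eq)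
      then show ?case by blast
    qed
  qed
  then show thesis using that by blast
qed


section \<open>The projective tensor product\<close>

definition proj_norm :: "('a::complex_normed_vector, 'b::complex_normed_vector) atensor \<Rightarrow> real"
  where "proj_norm u =
    Inf {(\<Sum>(x, y)\<leftarrow>xs. norm x * norm y) | xs. u = (\<Sum>(x, y)\<leftarrow>xs. x \<otimes>\<^sub>a y)}"

lemma sum_list_norm_nonneg: "0 \<le> (\<Sum>(x, y)\<leftarrow>xs. norm x * norm y)"
  by (induction xs) auto

lemma proj_norm_le:
  "u = (\<Sum>(x, y)\<leftarrow>xs. x \<otimes>\<^sub>a y) \<Longrightarrow> proj_norm u \<le> (\<Sum>(x, y)\<leftarrow>xs. norm x * norm y)"
  unfolding proj_norm_def
  by (rule cInf_lower) (auto intro!: bdd_belowI[of _ 0] sum_list_norm_nonneg)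

lemma proj_norm_greatest:
  assumes "\<And>xs. u = (\<Sum>(x, y)\<leftarrow>xs. x \<otimes>\<^sub>a y) \<Longrightarrow> K \<le> (\<Sum>(x, y)\<leftarrow>xs. norm x * norm y)"
  shows "K \<le> proj_norm u"
proof -
  obtain xs where "u = (\<Sum>(x, y)\<leftarrow>xs. x \<otimes>\<^sub>a y)" by (rule atensor_representation)
  then show ?thesis
    unfolding proj_norm_def using assms by (intro cInf_greatest) auto
qed

lemma proj_norm_nonneg: "0 \<le> proj_norm u"
  by (rule proj_norm_greatest) (rule sum_list_norm_nonneg)

lemma proj_norm_zero [simp]:
  "proj_norm (0 :: ('a::complex_normed_vector, 'b::complex_normed_vector) atensor) = 0"
  using proj_norm_le[of "0 :: ('a, 'b) atensor" "[]"] proj_norm_nonneg[of "0 :: ('a, 'b) atensor"]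
  by simp

lemma proj_norm_of_le: "proj_norm (x \<otimes>\<^sub>a y) \<le> norm x * norm y"
  using proj_norm_le[of "x \<otimes>\<^sub>a y" "[(x, y)]"] by simp

lemma proj_norm_triangle: "proj_norm (u + v) \<le> proj_norm u + proj_norm v"
proof -
  have "proj_norm (u + v) - (\<Sum>(x, y)\<leftarrow>ys. norm x * norm y) \<le> proj_norm u"
    if "v = (\<Sum>(x, y)\<leftarrow>ys. x \<otimes>\<^sub>a y)" for ys
  proof (rule proj_norm_greatest)
    fix xs assume "u = (\<Sum>(x, y)\<leftarrow>xs. x \<otimes>\<^sub>a y)"
    then show "proj_norm (u + v) - (\<Sum>(x, y)\<leftarrow>ys. norm x * norm y) \<le> (\<Sum>(x, y)\<leftarrow>xs. norm x * norm y)"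
      using proj_norm_le[of "u + v" "xs @ ys"] that by simp
  qed
  then have "proj_norm (u + v) - proj_norm u \<le> proj_norm v"
    by (intro proj_norm_greatest) (simp add: algebra_simps)
  then show ?thesis by simp
qed

lemma proj_norm_scaleC_le: "proj_norm (c *\<^sub>C u) \<le> cmod c * proj_norm u"
proof (cases "c = 0")
  case False
  have "proj_norm (c *\<^sub>C u) / cmod c \<le> proj_norm u"
  proof (rule proj_norm_greatest)
    fix xs assume u: "u = (\<Sum>(x, y)\<leftarrow>xs. x \<otimes>\<^sub>a y)"
    have "c *\<^sub>C (\<Sum>(x, y)\<leftarrow>xs. x \<otimes>\<^sub>a y) = (\<Sum>(x, y)\<leftarrow>map (\<lambda>(x, y). (c *\<^sub>C x, y)) xs. x \<otimes>\<^sub>a y)"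
      by (induction xs) (auto simp: atensor_of_simps(3) scaleC_add_right)
    then have "proj_norm (c *\<^sub>C u) \<le> (\<Sum>(x, y)\<leftarrow>map (\<lambda>(x, y). (c *\<^sub>C x, y)) xs. norm x * norm y)"
      unfolding u by (rule proj_norm_le)
    also have "\<dots> = cmod c * (\<Sum>(x, y)\<leftarrow>xs. norm x * norm y)"
      by (induction xs) (auto simp: norm_scaleC algebra_simps)
    finally show "proj_norm (c *\<^sub>C u) / cmod c \<le> (\<Sum>(x, y)\<leftarrow>xs. norm x * norm y)"
      using False by (simp add: field_simps)
  qed
  then show ?thesis using False by (simp add: field_simps)
qed simp

lemma proj_norm_scaleC: "proj_norm (c *\<^sub>C u) = cmod c * proj_norm u"
proof (cases "c = 0")
  case False
  have "proj_norm (inverse c *\<^sub>C c *\<^sub>C u) \<le> cmod (inverse c) * proj_norm (c *\<^sub>C u)"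
    by (rule proj_norm_scaleC_le)
  then have "cmod c * proj_norm u \<le> proj_norm (c *\<^sub>C u)"
    using False by (simp add: scaleC_scaleC norm_inverse field_simps norm_divide)
  then show ?thesis using proj_norm_scaleC_le[of c u] by simp
qed simp

lemma proj_norm_minus: "proj_norm (- u) = proj_norm u"
  using proj_norm_scaleC[of "-1" u] by (simp add: scaleC_minus1)

lemma proj_norm_commute: "proj_norm (u - v) = proj_norm (v - u)"
  using proj_norm_minus[of "u - v"] by simp

lemma proj_norm_diff_triangle: "proj_norm (u - w) \<le> proj_norm (u - v) + proj_norm (v - w)"
  using proj_norm_triangle[of "u - v" "v - w"] by simp

lemma proj_norm_diff_abs: "\<bar>proj_norm u - proj_norm v\<bar> \<le> proj_norm (u - v)"
  using proj_norm_triangle[of "u - v" v] proj_norm_triangle[of "v - u" u]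
  by (simp add: proj_norm_commute[of v u])

lemma atensor_lift_bound:
  assumes B: "cbilinear B" and K: "K \<ge> 0" "\<And>x y. norm (B x y) \<le> norm x * norm y * K"
  shows "norm (atensor_lift B u) \<le> K * proj_norm u"
proof (cases "K = 0")
  case True
  obtain xs where u: "u = (\<Sum>(x, y)\<leftarrow>xs. x \<otimes>\<^sub>a y)" by (rule atensor_representation)
  have "B x y = 0" for x y using K(2)[of x y] True by simp
  then have "atensor_lift B u = 0"
    unfolding u by (induction xs)
      (auto simp: clinear_add[OF clinear_atensor_lift] clinear_zero[OF clinear_atensor_lift]
        atensor_lift_of[OF B])
  then show ?thesis using True by simp
next
  case False
  have "norm (atensor_lift B u) / K \<le> proj_norm u"
  proof (rule proj_norm_greatest)
    fix xs assume u: "u = (\<Sum>(x, y)\<leftarrow>xs. x \<otimes>\<^sub>a y)"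
    have "norm (atensor_lift B (\<Sum>(x, y)\<leftarrow>xs. x \<otimes>\<^sub>a y)) \<le> K * (\<Sum>(x, y)\<leftarrow>xs. norm x * norm y)"
    proof (induction xs)
      case Nil
      then show ?case by (simp add: clinear_zero[OF clinear_atensor_lift])
    next
      case (Cons p xs)
      then show ?case
        using K(2)[of "fst p" "snd p"]
        by (auto simp: clinear_add[OF clinear_atensor_lift] atensor_lift_of[OF B] case_prod_unfold
            algebra_simps intro: norm_triangle_le)
    qed
    then show "norm (atensor_lift B u) / K \<le> (\<Sum>(x, y)\<leftarrow>xs. norm x * norm y)"
      using False K(1) u by (simp add: field_simps)
  qed
  then show ?thesis using False K(1) by (simp add: field_simps)
qed

text \<open>
  The completion of the algebraic tensor product with respect to \<open>proj_norm\<close>: Cauchy sequences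
  modulo null sequences. That \<open>proj_norm\<close> is definite is not needed for this construction.
\<close>

definition proj_Cauchy ::
    "(nat \<Rightarrow> ('a::complex_normed_vector, 'b::complex_normed_vector) atensor) \<Rightarrow> bool"
  where "proj_Cauchy X \<longleftrightarrow> (\<forall>e>0. \<exists>N. \<forall>m\<ge>N. \<forall>n\<ge>N. proj_norm (X m - X n) < e)"

definition proj_equiv ::
    "(nat \<Rightarrow> ('a::complex_normed_vector, 'b::complex_normed_vector) atensor) \<Rightarrow>
     (nat \<Rightarrow> ('a, 'b) atensor) \<Rightarrow> bool"
  where "proj_equiv X Y \<longleftrightarrow>
    proj_Cauchy X \<and> proj_Cauchy Y \<and> (\<lambda>n. proj_norm (X n - Y n)) \<longlonglongrightarrow> 0"

lemma proj_Cauchy_const: "proj_Cauchy (\<lambda>_. u)"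
  by (auto simp: proj_Cauchy_def)

lemma null_le:
  assumes "f \<longlonglongrightarrow> (0::real)" "\<And>n. 0 \<le> g n" "\<And>n. g n \<le> f n" shows "g \<longlonglongrightarrow> 0"
  by (rule tendsto_sandwich[OF _ _ tendsto_const assms(1)]) (auto simp: assms)

quotient_type (overloaded) ('a, 'b) ptensor =
    "nat \<Rightarrow> ('a::complex_normed_vector, 'b::complex_normed_vector) atensor" / partial: proj_equiv
proof (rule part_equivpI)
  show "\<exists>X :: nat \<Rightarrow> ('a, 'b) atensor. proj_equiv X X"
    by (rule exI[of _ "\<lambda>_. 0"]) (simp add: proj_equiv_def proj_Cauchy_const)
  show "symp (proj_equiv :: (nat \<Rightarrow> ('a, 'b) atensor) \<Rightarrow> _)"
    by (auto simp: symp_def proj_equiv_def proj_norm_commute)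
  show "transp (proj_equiv :: (nat \<Rightarrow> ('a, 'b) atensor) \<Rightarrow> _)"
  proof (rule transpI)
    fix X Y Z :: "nat \<Rightarrow> ('a, 'b) atensor"
    assume XY: "proj_equiv X Y" and YZ: "proj_equiv Y Z"
    have "(\<lambda>n. proj_norm (X n - Y n) + proj_norm (Y n - Z n)) \<longlonglongrightarrow> 0"
      using XY YZ by (auto simp: proj_equiv_def intro: tendsto_add_zero)
    then have "(\<lambda>n. proj_norm (X n - Z n)) \<longlonglongrightarrow> 0"
      by (rule null_le) (auto intro: proj_norm_nonneg proj_norm_diff_triangle)
    then show "proj_equiv X Z" using XY YZ by (auto simp: proj_equiv_def)
  qed
qed

lemma proj_equiv_refl_iff: "proj_equiv X X \<longleftrightarrow> proj_Cauchy X"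
  by (auto simp: proj_equiv_def)

lemma proj_Cauchy_add:
  assumes "proj_Cauchy X" "proj_Cauchy Y" shows "proj_Cauchy (\<lambda>n. X n + Y n)"
  unfolding proj_Cauchy_def
proof (intro allI impI)
  fix e :: real assume "e > 0"
  then obtain M N where
    M: "\<And>m n. m \<ge> M \<Longrightarrow> n \<ge> M \<Longrightarrow> proj_norm (X m - X n) < e / 2" and
    N: "\<And>m n. m \<ge> N \<Longrightarrow> n \<ge> N \<Longrightarrow> proj_norm (Y m - Y n) < e / 2"
    using assms unfolding proj_Cauchy_def by (meson half_gt_zero)
  have "proj_norm ((X m + Y m) - (X n + Y n)) < e" if "m \<ge> max M N" "n \<ge> max M N" for m n
    using M[of m n] N[of m n] that proj_norm_triangle[of "X m - X n" "Y m - Y n"]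
    by (simp add: add_diff_add)
  then show "\<exists>N. \<forall>m\<ge>N. \<forall>n\<ge>N. proj_norm ((X m + Y m) - (X n + Y n)) < e" by blast
qed

lemma proj_Cauchy_scaleC:
  assumes "proj_Cauchy X" shows "proj_Cauchy (\<lambda>n. c *\<^sub>C X n)"
proof (cases "c = 0")
  case False
  show ?thesis
    unfolding proj_Cauchy_def
  proof (intro allI impI)
    fix e :: real assume "e > 0"
    then have "e / cmod c > 0" using False by simp
    then obtain N where "\<And>m n. m \<ge> N \<Longrightarrow> n \<ge> N \<Longrightarrow> proj_norm (X m - X n) < e / cmod c"
      using assms unfolding proj_Cauchy_def by meson
    then show "\<exists>N. \<forall>m\<ge>N. \<forall>n\<ge>N. proj_norm (c *\<^sub>C X m - c *\<^sub>C X n) < e"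
      using False by (intro exI[of _ N])
        (simp add: proj_norm_scaleC field_simps flip: scaleC_diff_right)
  qed
qed (simp add: proj_Cauchy_const)

lemma proj_Cauchy_minus: "proj_Cauchy X \<Longrightarrow> proj_Cauchy (\<lambda>n. - X n)"
  using proj_Cauchy_scaleC[of X "-1"] by (simp add: scaleC_minus1)

lemma proj_Cauchy_convergent_norm:
  assumes "proj_Cauchy X" shows "convergent (\<lambda>n. proj_norm (X n))"
proof -
  have "Cauchy (\<lambda>n. proj_norm (X n))"
    unfolding Cauchy_def dist_real_def
    using assms proj_norm_diff_abs unfolding proj_Cauchy_def by (meson le_less_trans)
  then show ?thesis by (simp add: Cauchy_convergent_iff)
qed

lemma lim_proj_norm_cong:
  assumes "proj_equiv X Y" shows "lim (\<lambda>n. proj_norm (X n)) = lim (\<lambda>n. proj_norm (Y n))"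
proof -
  have "(\<lambda>n. proj_norm (X n - Y n)) \<longlonglongrightarrow> 0" using assms by (simp add: proj_equiv_def)
  then have "(\<lambda>n. \<bar>proj_norm (X n) - proj_norm (Y n)\<bar>) \<longlonglongrightarrow> 0"
    by (rule null_le) (auto intro: proj_norm_diff_abs)
  then have "(\<lambda>n. proj_norm (X n) - proj_norm (Y n)) \<longlonglongrightarrow> 0"
    by (rule tendsto_rabs_zero_cancel)
  moreover have "(\<lambda>n. proj_norm (X n)) \<longlonglongrightarrow> lim (\<lambda>n. proj_norm (X n))"
    using assms by (simp add: proj_equiv_def proj_Cauchy_convergent_norm flip: convergent_LIMSEQ_iff)
  ultimately have "(\<lambda>n. proj_norm (Y n)) \<longlonglongrightarrow> lim (\<lambda>n. proj_norm (X n))"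
    using tendsto_diff by fastforce
  then show ?thesis by (simp add: limI)
qed

instantiation ptensor :: (complex_normed_vector, complex_normed_vector) complex_normed_vector
begin

lift_definition zero_ptensor :: "('a, 'b) ptensor" is "\<lambda>_. 0"
  by (simp add: proj_equiv_refl_iff proj_Cauchy_const)
lift_definition plus_ptensor :: "('a, 'b) ptensor \<Rightarrow> ('a, 'b) ptensor \<Rightarrow> ('a, 'b) ptensor"
  is "\<lambda>X Y n. X n + Y n"
proof -
  fix X X' Y Y' :: "nat \<Rightarrow> ('a, 'b) atensor"
  assume XY: "proj_equiv X X'" "proj_equiv Y Y'"
  then have "(\<lambda>n. proj_norm (X n - X' n) + proj_norm (Y n - Y' n)) \<longlonglongrightarrow> 0"
    by (auto simp: proj_equiv_def intro: tendsto_add_zero)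
  then have "(\<lambda>n. proj_norm ((X n + Y n) - (X' n + Y' n))) \<longlonglongrightarrow> 0"
    by (rule null_le) (auto intro: proj_norm_nonneg simp: add_diff_add proj_norm_triangle)
  then show "proj_equiv (\<lambda>n. X n + Y n) (\<lambda>n. X' n + Y' n)"
    using XY by (auto simp: proj_equiv_def intro: proj_Cauchy_add)
qed
lift_definition scaleC_ptensor :: "complex \<Rightarrow> ('a, 'b) ptensor \<Rightarrow> ('a, 'b) ptensor"
  is "\<lambda>c X n. c *\<^sub>C X n"
  by (auto simp: proj_equiv_def proj_Cauchy_scaleC proj_norm_scaleC simp flip: scaleC_diff_right
      intro: tendsto_mult_right_zero)
lift_definition norm_ptensor :: "('a, 'b) ptensor \<Rightarrow> real" is "\<lambda>X. lim (\<lambda>n. proj_norm (X n))"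
  by (rule lim_proj_norm_cong)
definition uminus_ptensor :: "('a, 'b) ptensor \<Rightarrow> ('a, 'b) ptensor"
  where "uminus_ptensor t = (- 1) *\<^sub>C t"
definition minus_ptensor :: "('a, 'b) ptensor \<Rightarrow> ('a, 'b) ptensor \<Rightarrow> ('a, 'b) ptensor"
  where "minus_ptensor s t = s + - t"
definition scaleR_ptensor :: "real \<Rightarrow> ('a, 'b) ptensor \<Rightarrow> ('a, 'b) ptensor"
  where "scaleR_ptensor r t = complex_of_real r *\<^sub>C t"
definition dist_ptensor :: "('a, 'b) ptensor \<Rightarrow> ('a, 'b) ptensor \<Rightarrow> real"
  where "dist_ptensor s t = norm (s - t)"
definition sgn_ptensor :: "('a, 'b) ptensor \<Rightarrow> ('a, 'b) ptensor"
  where "sgn_ptensor t = scaleR (inverse (norm t)) t"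
definition uniformity_ptensor :: "(('a, 'b) ptensor \<times> ('a, 'b) ptensor) filter"
  where "uniformity_ptensor = (INF e\<in>{0 <..}. principal {(s, t). dist s t < e})"
definition open_ptensor :: "('a, 'b) ptensor set \<Rightarrow> bool"
  where "open_ptensor S = (\<forall>x\<in>S. \<forall>\<^sub>F (x', y) in uniformity. x' = x \<longrightarrow> y \<in> S)"

instance
proof
  fix s t u :: "('a, 'b) ptensor" and c d :: complex and q r :: real
  have eq: "proj_equiv X Y" if "proj_Cauchy X" "X = Y" for X Y :: "nat \<Rightarrow> ('a, 'b) atensor"
    using that by (simp add: proj_equiv_def)
  note C = proj_equiv_refl_iff proj_Cauchy_add proj_Cauchy_scaleC proj_Cauchy_minus
  show "s + t + u = s + (t + u)" by transfer (rule eq, simp_all add: C add.assoc)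
  show "s + t = t + s" by transfer (rule eq, simp_all add: C add.commute)
  show "0 + t = t" by transfer (rule eq, simp_all add: C)
  show "- t + t = 0" unfolding uminus_ptensor_def
    by transfer (rule eq, simp_all add: C scaleC_minus1 proj_Cauchy_const)
  show "s - t = s + - t" by (rule minus_ptensor_def)
  show addC: "c *\<^sub>C (s + t) = c *\<^sub>C s + c *\<^sub>C t" for c
    by transfer (rule eq, simp_all add: C scaleC_add_right)
  show addC': "(c + d) *\<^sub>C t = c *\<^sub>C t + d *\<^sub>C t" for c d
    by transfer (rule eq, simp_all add: C scaleC_add_left)
  show CC: "c *\<^sub>C d *\<^sub>C t = (c * d) *\<^sub>C t" for c d
    by transfer (rule eq, simp_all add: C scaleC_scaleC)
  have C1: "1 *\<^sub>C t = t"
    by transfer (rule eq, simp_all add: C)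
  show "complex_of_real r *\<^sub>C t = r *\<^sub>R t" by (rule scaleR_ptensor_def[symmetric])
  show "r *\<^sub>R (s + t) = r *\<^sub>R s + r *\<^sub>R t" "(q + r) *\<^sub>R t = q *\<^sub>R t + r *\<^sub>R t"
    "q *\<^sub>R r *\<^sub>R t = (q * r) *\<^sub>R t" "1 *\<^sub>R t = t"
    by (simp_all add: scaleR_ptensor_def addC addC' CC C1)
  show "dist s t = norm (s - t)" by (rule dist_ptensor_def)
  show "sgn t = scaleR (inverse (norm t)) t" by (rule sgn_ptensor_def)
  show "uniformity = (INF e\<in>{0<..}. principal {(s, t :: ('a, 'b) ptensor). dist s t < e})"
    by (rule uniformity_ptensor_def)
  show "open S = (\<forall>x\<in>S. \<forall>\<^sub>F (x', y) in uniformity. x' = x \<longrightarrow> y \<in> S)" for S :: "('a, 'b) ptensor set"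
    by (rule open_ptensor_def)
  have lim: "(\<lambda>n. proj_norm (X n)) \<longlonglongrightarrow> lim (\<lambda>n. proj_norm (X n))"
    if "proj_equiv X X" for X :: "nat \<Rightarrow> ('a, 'b) atensor"
    using that by (simp add: proj_equiv_refl_iff proj_Cauchy_convergent_norm flip: convergent_LIMSEQ_iff)
  show "norm (s + t) \<le> norm s + norm t"
  proof (transfer, goal_cases)
    case (1 X Y)
    have "proj_equiv (\<lambda>n. X n + Y n) (\<lambda>n. X n + Y n)" using 1 by (simp add: C)
    then show ?case
      using 1 by (intro LIMSEQ_le[OF lim tendsto_add[OF lim lim]]) (auto intro: proj_norm_triangle)
  qed
  show "(norm t = 0) = (t = 0)"
  proof (transfer, goal_cases)
    case (1 X)
    show ?case
      using lim[OF 1] 1 by (auto simp: proj_equiv_def proj_Cauchy_const dest: limI)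
  qed
  show norm_C: "norm (c *\<^sub>C t) = cmod c * norm t" for c
  proof (transfer, goal_cases)
    case (1 c X)
    show ?case
      by (rule limI) (simp add: proj_norm_scaleC tendsto_mult_left lim[OF 1])
  qed
  show "norm (r *\<^sub>R t) = \<bar>r\<bar> * norm t" by (simp add: scaleR_ptensor_def norm_C)
qed

end

lemma abs_ptensor_diff:
  assumes "proj_Cauchy X" "proj_Cauchy Y"
  shows "abs_ptensor X - abs_ptensor Y = abs_ptensor (\<lambda>n. X n - Y n)"
proof -
  have "proj_Cauchy (\<lambda>n. (- 1) *\<^sub>C Y n)" by (rule proj_Cauchy_scaleC[OF assms(2)])
  then have "abs_ptensor X + (- 1) *\<^sub>C abs_ptensor Y = abs_ptensor (\<lambda>n. X n + (- 1) *\<^sub>C Y n)"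
    using assms by (simp add: scaleC_ptensor.abs_eq plus_ptensor.abs_eq proj_equiv_refl_iff)
  then show ?thesis by (simp add: scaleC_minus1)
qed

definition ptensor_of_atensor ::
    "('a::complex_normed_vector, 'b::complex_normed_vector) atensor \<Rightarrow> ('a, 'b) ptensor"
  where "ptensor_of_atensor u = abs_ptensor (\<lambda>_. u)"

lemma clinear_ptensor_of_atensor: "clinear ptensor_of_atensor"
  unfolding clinear_def ptensor_of_atensor_def
  by (simp add: plus_ptensor.abs_eq scaleC_ptensor.abs_eq proj_equiv_refl_iff proj_Cauchy_const)

lemma norm_ptensor_of_atensor: "norm (ptensor_of_atensor u) = proj_norm u"
  unfolding ptensor_of_atensor_def
  by (simp add: norm_ptensor.abs_eq proj_equiv_refl_iff proj_Cauchy_const)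

lemma ptensor_of_atensor_tendsto:
  assumes X: "proj_Cauchy X"
  shows "(\<lambda>n. ptensor_of_atensor (X n)) \<longlonglongrightarrow> abs_ptensor X"
proof (rule LIMSEQ_I)
  fix e :: real assume "e > 0"
  then obtain N where N: "\<And>m n. m \<ge> N \<Longrightarrow> n \<ge> N \<Longrightarrow> proj_norm (X m - X n) < e / 2"
    using X unfolding proj_Cauchy_def by (meson half_gt_zero)
  have "norm (ptensor_of_atensor (X n) - abs_ptensor X) < e" if n: "n \<ge> N" for n
  proof -
    have C: "proj_Cauchy (\<lambda>k. X n - X k)"
      using proj_Cauchy_add[OF proj_Cauchy_const proj_Cauchy_minus[OF X], of "X n"] by simp
    have "norm (ptensor_of_atensor (X n) - abs_ptensor X) = lim (\<lambda>k. proj_norm (X n - X k))"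
      unfolding ptensor_of_atensor_def
      by (simp add: abs_ptensor_diff[OF proj_Cauchy_const X] norm_ptensor.abs_eq
          proj_equiv_refl_iff C)
    moreover have "lim (\<lambda>k. proj_norm (X n - X k)) \<le> e / 2"
      using proj_Cauchy_convergent_norm[OF C] N[OF n]
      by (intro LIMSEQ_le_const2[of "\<lambda>k. proj_norm (X n - X k)"])
        (auto simp: convergent_LIMSEQ_iff intro!: exI[of _ N] less_imp_le)
    ultimately show ?thesis using \<open>e > 0\<close> by simp
  qed
  then show "\<exists>N. \<forall>n\<ge>N. norm (ptensor_of_atensor (X n) - abs_ptensor X) < e" by blast
qed

lemma ptensor_cases:
  obtains X where "proj_Cauchy X" "t = abs_ptensor X"
proof -
  have "\<exists>X. proj_Cauchy X \<and> t = abs_ptensor X"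
    by (induction t rule: ptensor.abs_induct) (auto simp: proj_equiv_refl_iff)
  then show thesis using that by blast
qed

lemma ptensor_dense:
  assumes "e > 0" obtains u where "norm (t - ptensor_of_atensor u) < e"
proof -
  obtain X where X: "proj_Cauchy X" "t = abs_ptensor X" by (rule ptensor_cases)
  obtain n where "norm (ptensor_of_atensor (X n) - t) < e"
    using LIMSEQ_D[OF ptensor_of_atensor_tendsto[OF X(1)] assms] X(2) by blast
  then show thesis using that by (metis norm_minus_commute)
qed

instance ptensor :: (complex_normed_vector, complex_normed_vector) cbanach
proof
  fix T :: "nat \<Rightarrow> ('a, 'b) ptensor" assume T: "Cauchy T"
  have "\<exists>u. norm (T n - ptensor_of_atensor u) < inverse (real (Suc n))" for n
    using ptensor_dense[of "inverse (real (Suc n))" "T n"] by auto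
  then obtain u where u: "\<And>n. norm (T n - ptensor_of_atensor (u n)) < inverse (real (Suc n))"
    by metis
  have "(\<lambda>n. norm (T n - ptensor_of_atensor (u n))) \<longlonglongrightarrow> 0"
    by (rule null_le[OF LIMSEQ_inverse_real_of_nat]) (auto intro: less_imp_le[OF u, simplified])
  then have Tu: "(\<lambda>n. T n - ptensor_of_atensor (u n)) \<longlonglongrightarrow> 0"
    by (rule tendsto_norm_zero_cancel)
  have "Cauchy (\<lambda>n. ptensor_of_atensor (u n))"
  proof (rule CauchyI)
    fix e :: real assume "e > 0"
    then obtain M N where
      M: "\<And>m n. m \<ge> M \<Longrightarrow> n \<ge> M \<Longrightarrow> norm (T m - T n) < e / 3" and
      N: "\<And>n. n \<ge> N \<Longrightarrow> norm (T n - ptensor_of_atensor (u n) - 0) < e / 3"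
      using CauchyD[OF T, of "e / 3"] LIMSEQ_D[OF Tu, of "e / 3"] by auto
    have "norm (ptensor_of_atensor (u m) - ptensor_of_atensor (u n)) < e"
      if mn: "m \<ge> max M N" "n \<ge> max M N" for m n
    proof -
      have "norm (ptensor_of_atensor (u m) - ptensor_of_atensor (u n)) =
          norm ((T m - T n) - (T m - ptensor_of_atensor (u m)) + (T n - ptensor_of_atensor (u n)))"
        by simp
      also have "\<dots> \<le> norm (T m - T n) + norm (T m - ptensor_of_atensor (u m))
          + norm (T n - ptensor_of_atensor (u n))"
        by (rule order_trans[OF norm_triangle_ineq add_right_mono[OF norm_triangle_ineq4]])
      also have "\<dots> < e" using M[of m n] N[of m] N[of n] mn by simp
      finally show ?thesis .
    qed
    then show "\<exists>N. \<forall>m\<ge>N. \<forall>n\<ge>N.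
        norm (ptensor_of_atensor (u m) - ptensor_of_atensor (u n)) < e" by blast
  qed
  then have "proj_Cauchy u"
    unfolding proj_Cauchy_def Cauchy_def dist_norm
    by (simp flip: clinear_diff[OF clinear_ptensor_of_atensor] norm_ptensor_of_atensor)
  then have "(\<lambda>n. (T n - ptensor_of_atensor (u n)) + ptensor_of_atensor (u n)) \<longlonglongrightarrow> 0 + abs_ptensor u"
    by (intro tendsto_add Tu ptensor_of_atensor_tendsto)
  then show "convergent T" by (auto simp: convergent_def)
qed

definition ptensor_of :: "'a::complex_normed_vector \<Rightarrow> 'b::complex_normed_vector \<Rightarrow> ('a, 'b) ptensor"
    (infixl \<open>\<otimes>\<^sub>p\<close> 70)
  where "x \<otimes>\<^sub>p y = ptensor_of_atensor (x \<otimes>\<^sub>a y)"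

lemma norm_ptensor_of_le: "norm (x \<otimes>\<^sub>p y) \<le> norm x * norm y"
  by (simp add: ptensor_of_def norm_ptensor_of_atensor proj_norm_of_le)

lemma ptensor_of_simps:
  "(x + x') \<otimes>\<^sub>p y = x \<otimes>\<^sub>p y + x' \<otimes>\<^sub>p y" "x \<otimes>\<^sub>p (y + y') = x \<otimes>\<^sub>p y + x \<otimes>\<^sub>p y'"
  "(c *\<^sub>C x) \<otimes>\<^sub>p y = c *\<^sub>C (x \<otimes>\<^sub>p y)" "x \<otimes>\<^sub>p (c *\<^sub>C y) = c *\<^sub>C (x \<otimes>\<^sub>p y)"
  unfolding ptensor_of_def atensor_of_simps
  by (simp_all only: clinear_add[OF clinear_ptensor_of_atensor]
      clinear_scaleC[OF clinear_ptensor_of_atensor])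

lemma bounded_cbilinearI:
  assumes "\<And>x x' y. B (x + x') y = B x y + B x' y" "\<And>x y y'. B x (y + y') = B x y + B x y'"
    "\<And>c x y. B (c *\<^sub>C x) y = c *\<^sub>C B x y" "\<And>c x y. B x (c *\<^sub>C y) = c *\<^sub>C B x y"
    "\<And>x y. norm (B x y) \<le> norm x * norm y * K"
  shows "bounded_cbilinear B"
  using assms by (auto simp: bounded_cbilinear_def cbilinear_def clinear_def)

lemma bounded_cbilinear_ptensor_of: "bounded_cbilinear (\<otimes>\<^sub>p)"
  by (rule bounded_cbilinearI[of _ 1]) (simp_all add: ptensor_of_simps norm_ptensor_of_le)

lemma atensor_lift_convergent:
  fixes B :: "'a::complex_normed_vector \<Rightarrow> 'b::complex_normed_vector \<Rightarrow> 'c::cbanach"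
  assumes B: "bounded_cbilinear B" and X: "proj_Cauchy X"
  shows "convergent (\<lambda>n. atensor_lift B (X n))"
proof -
  obtain K where K: "K \<ge> 0" "\<And>x y. norm (B x y) \<le> norm x * norm y * K"
    using bounded_cbilinear_bound[OF B] by blast
  have bd: "norm (atensor_lift B u) \<le> (K + 1) * proj_norm u" for u
    using atensor_lift_bound[OF _ K, of u] B proj_norm_nonneg[of u]
    by (simp add: bounded_cbilinear_def algebra_simps)
  have "Cauchy (\<lambda>n. atensor_lift B (X n))"
  proof (rule CauchyI)
    fix e :: real assume "e > 0"
    then have "e / (K + 1) > 0" using K(1) by simp
    then obtain N where N: "\<And>m n. m \<ge> N \<Longrightarrow> n \<ge> N \<Longrightarrow> proj_norm (X m - X n) < e / (K + 1)"
      using X unfolding proj_Cauchy_def by meson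
    have "norm (atensor_lift B (X m) - atensor_lift B (X n)) < e" if "m \<ge> N" "n \<ge> N" for m n
    proof -
      have "norm (atensor_lift B (X m) - atensor_lift B (X n)) \<le> (K + 1) * proj_norm (X m - X n)"
        using bd[of "X m - X n"] by (simp add: clinear_diff[OF clinear_atensor_lift])
      also have "\<dots> < e" using N[OF that] K(1) by (simp add: field_simps)
      finally show ?thesis .
    qed
    then show "\<exists>N. \<forall>m\<ge>N. \<forall>n\<ge>N. norm (atensor_lift B (X m) - atensor_lift B (X n)) < e" by blast
  qed
  then show ?thesis by (simp add: Cauchy_convergent_iff)
qed

text \<open>The universal property: bounded bilinear maps extend to the projective tensor product.\<close>

lift_definition ptensor_lift ::
    "('a::complex_normed_vector \<Rightarrow> 'b::complex_normed_vector \<Rightarrow> 'c::cbanach) \<Rightarrow> ('a, 'b) ptensor \<Rightarrow> 'c"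
  is "\<lambda>B X. if bounded_cbilinear B then lim (\<lambda>n. atensor_lift B (X n)) else 0"
proof -
  fix B :: "'a \<Rightarrow> 'b \<Rightarrow> 'c" and X Y :: "nat \<Rightarrow> ('a, 'b) atensor"
  assume XY: "proj_equiv X Y"
  have "lim (\<lambda>n. atensor_lift B (X n)) = lim (\<lambda>n. atensor_lift B (Y n))" if B: "bounded_cbilinear B"
  proof -
    obtain K where K: "K \<ge> 0" "\<And>x y. norm (B x y) \<le> norm x * norm y * K"
      using bounded_cbilinear_bound[OF B] by blast
    have "(\<lambda>n. K * proj_norm (X n - Y n)) \<longlonglongrightarrow> 0"
      using XY by (auto simp: proj_equiv_def intro: tendsto_mult_right_zero)
    then have "(\<lambda>n. norm (atensor_lift B (X n) - atensor_lift B (Y n))) \<longlonglongrightarrow> 0"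
      by (rule null_le)
        (use B in \<open>auto simp: bounded_cbilinear_def
           intro!: atensor_lift_bound[OF _ K] simp flip: clinear_diff[OF clinear_atensor_lift]\<close>)
    then have "(\<lambda>n. atensor_lift B (X n) - atensor_lift B (Y n)) \<longlonglongrightarrow> 0"
      by (rule tendsto_norm_zero_cancel)
    moreover have "(\<lambda>n. atensor_lift B (X n)) \<longlonglongrightarrow> lim (\<lambda>n. atensor_lift B (X n))"
      using XY atensor_lift_convergent[OF B, of X] by (simp add: proj_equiv_def convergent_LIMSEQ_iff)
    ultimately have "(\<lambda>n. atensor_lift B (Y n)) \<longlonglongrightarrow> lim (\<lambda>n. atensor_lift B (X n))"
      using tendsto_diff by fastforce
    then show ?thesis by (simp add: limI)
  qed
  then show "(if bounded_cbilinear B then lim (\<lambda>n. atensor_lift B (X n)) else 0) =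
      (if bounded_cbilinear B then lim (\<lambda>n. atensor_lift B (Y n)) else 0)" by simp
qed

lemma ptensor_lift_tendsto:
  assumes B: "bounded_cbilinear B" and X: "proj_Cauchy X"
  shows "(\<lambda>n. atensor_lift B (X n)) \<longlonglongrightarrow> ptensor_lift B (abs_ptensor X)"
  using atensor_lift_convergent[OF assms] assms
  by (simp add: ptensor_lift.abs_eq proj_equiv_refl_iff convergent_LIMSEQ_iff)

lemma ptensor_lift_of_atensor:
  "bounded_cbilinear B \<Longrightarrow> ptensor_lift B (ptensor_of_atensor u) = atensor_lift B u"
  using LIMSEQ_unique[OF ptensor_lift_tendsto[OF _ proj_Cauchy_const[of u]] tendsto_const]
  by (simp add: ptensor_of_atensor_def)

lemma ptensor_lift_of: "bounded_cbilinear B \<Longrightarrow> ptensor_lift B (x \<otimes>\<^sub>p y) = B x y"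
  by (simp add: ptensor_of_def ptensor_lift_of_atensor atensor_lift_of bounded_cbilinear_def)

lemma ptensor_lift_bound:
  assumes B: "bounded_cbilinear B" and K: "K \<ge> 0" "\<And>x y. norm (B x y) \<le> norm x * norm y * K"
  shows "norm (ptensor_lift B t) \<le> K * norm t"
proof -
  obtain X where X: "proj_Cauchy X" "t = abs_ptensor X" by (rule ptensor_cases)
  show ?thesis
    unfolding X(2)
  proof (rule LIMSEQ_le[OF tendsto_norm[OF ptensor_lift_tendsto[OF B X(1)]]
        tendsto_mult_left[OF tendsto_norm[OF ptensor_of_atensor_tendsto[OF X(1)]]]])
    show "\<exists>N. \<forall>n\<ge>N. norm (atensor_lift B (X n)) \<le> K * norm (ptensor_of_atensor (X n))"
      using B by (auto simp: norm_ptensor_of_atensor bounded_cbilinear_def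
          intro!: atensor_lift_bound[OF _ K])
  qed
qed

lemma bounded_clinear_ptensor_lift:
  fixes B :: "'a::complex_normed_vector \<Rightarrow> 'b::complex_normed_vector \<Rightarrow> 'c::cbanach"
  assumes B: "bounded_cbilinear B" shows "bounded_clinear (ptensor_lift B)"
proof -
  obtain K where K: "K \<ge> 0" "\<And>x y. norm (B x y) \<le> norm x * norm y * K"
    using bounded_cbilinear_bound[OF B] by blast
  show ?thesis
  proof (rule bounded_clinearI)
    fix s t :: "('a, 'b) ptensor" and c
    obtain X where X: "proj_Cauchy X" "s = abs_ptensor X" by (rule ptensor_cases)
    obtain Y where Y: "proj_Cauchy Y" "t = abs_ptensor Y" by (rule ptensor_cases)
    have st: "s + t = abs_ptensor (\<lambda>n. X n + Y n)" "c *\<^sub>C s = abs_ptensor (\<lambda>n. c *\<^sub>C X n)"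
      using X Y by (simp_all add: plus_ptensor.abs_eq scaleC_ptensor.abs_eq proj_equiv_refl_iff)
    show "ptensor_lift B (s + t) = ptensor_lift B s + ptensor_lift B t"
      using ptensor_lift_tendsto[OF B proj_Cauchy_add[OF X(1) Y(1)]]
        tendsto_add[OF ptensor_lift_tendsto[OF B X(1)] ptensor_lift_tendsto[OF B Y(1)]]
      by (intro LIMSEQ_unique)
        (auto simp: st(1) simp flip: X(2) Y(2) clinear_add[OF clinear_atensor_lift])
    have lin: "bounded_linear (\<lambda>z::'c. c *\<^sub>C z)"
      by (rule bounded_clinear_bounded_linear, rule bounded_clinearI[of _ "cmod c"])
        (auto simp: scaleC_add_right scaleC_scaleC norm_scaleC mult.commute)
    show "ptensor_lift B (c *\<^sub>C s) = c *\<^sub>C ptensor_lift B s"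
      using ptensor_lift_tendsto[OF B proj_Cauchy_scaleC[OF X(1), of c]]
        bounded_linear.tendsto[OF lin ptensor_lift_tendsto[OF B X(1)]]
      by (intro LIMSEQ_unique)
        (auto simp: st(2) simp flip: X(2) clinear_scaleC[OF clinear_atensor_lift])
    show "norm (ptensor_lift B s) \<le> norm s * K"
      using ptensor_lift_bound[OF B K, of s] by (simp add: mult.commute)
  qed
qed

lemma ptensor_ext:
  fixes S T :: "('a::complex_normed_vector, 'b::complex_normed_vector) ptensor \<Rightarrow> 'c::complex_normed_vector"
  assumes S: "bounded_clinear S" and T: "bounded_clinear T"
    and eq: "\<And>x y. S (x \<otimes>\<^sub>p y) = T (x \<otimes>\<^sub>p y)"
  shows "S = T"
proof
  fix t :: "('a, 'b) ptensor"
  have "S (ptensor_of_atensor u) = T (ptensor_of_atensor u)" for u :: "('a, 'b) atensor"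
  proof -
    obtain xs where u: "u = (\<Sum>(x, y)\<leftarrow>xs. x \<otimes>\<^sub>a y)" by (rule atensor_representation)
    show ?thesis
      unfolding u using eq
      by (induction xs)
        (auto simp: clinear_zero clinear_add clinear_ptensor_of_atensor ptensor_of_def
          bounded_clinear_clinear[OF S] bounded_clinear_clinear[OF T])
  qed
  moreover obtain X where X: "proj_Cauchy X" "t = abs_ptensor X" by (rule ptensor_cases)
  ultimately show "S t = T t"
    using bounded_linear.tendsto[OF bounded_clinear_bounded_linear[OF S] ptensor_of_atensor_tendsto[OF X(1)]]
      bounded_linear.tendsto[OF bounded_clinear_bounded_linear[OF T] ptensor_of_atensor_tendsto[OF X(1)]]
    by (auto intro: LIMSEQ_unique)
qed


section \<open>Strong pseudo-amenability\<close>

definition tensor_lmult :: "'a::complex_banach_algebra \<Rightarrow> ('a, 'a) ptensor \<Rightarrow> ('a, 'a) ptensor"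
  where "tensor_lmult a t = ptensor_lift (\<lambda>b c. (a * b) \<otimes>\<^sub>p c) t"

definition tensor_rmult :: "('a::complex_banach_algebra, 'a) ptensor \<Rightarrow> 'a \<Rightarrow> ('a, 'a) ptensor"
  where "tensor_rmult t a = ptensor_lift (\<lambda>b c. b \<otimes>\<^sub>p (c * a)) t"

definition product_map :: "('a::complex_banach_algebra, 'a) ptensor \<Rightarrow> 'a"
  where "product_map = ptensor_lift (*)"

lemma bounded_cbilinear_lmult:
  "bounded_cbilinear (\<lambda>b c. ((a::'a::complex_banach_algebra) * b) \<otimes>\<^sub>p (c::'b::complex_normed_vector))"
proof (rule bounded_cbilinearI)
  fix x :: 'a and y :: 'b
  have "norm ((a * x) \<otimes>\<^sub>p y) \<le> norm (a * x) * norm y" by (rule norm_ptensor_of_le)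
  also have "\<dots> \<le> norm a * norm x * norm y" by (intro mult_right_mono norm_mult_ineq norm_ge_zero)
  finally show "norm ((a * x) \<otimes>\<^sub>p y) \<le> norm x * norm y * norm a" by (simp add: ac_simps)
qed (simp_all add: ptensor_of_simps distrib_left scaleC_mult_right)

lemma bounded_cbilinear_rmult:
  "bounded_cbilinear (\<lambda>b c. (b::'b::complex_normed_vector) \<otimes>\<^sub>p (c * (a::'a::complex_banach_algebra)))"
proof (rule bounded_cbilinearI)
  fix x :: 'b and y :: 'a
  have "norm (x \<otimes>\<^sub>p (y * a)) \<le> norm x * norm (y * a)" by (rule norm_ptensor_of_le)
  also have "\<dots> \<le> norm x * (norm y * norm a)" by (intro mult_left_mono norm_mult_ineq norm_ge_zero)
  finally show "norm (x \<otimes>\<^sub>p (y * a)) \<le> norm x * norm y * norm a" by (simp add: ac_simps)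
qed (simp_all add: ptensor_of_simps distrib_right scaleC_mult_left)

lemma bounded_cbilinear_times: "bounded_cbilinear ((*) :: 'a::complex_banach_algebra \<Rightarrow> 'a \<Rightarrow> 'a)"
  by (rule bounded_cbilinearI[of _ 1])
    (simp_all add: distrib_left distrib_right scaleC_mult_left scaleC_mult_right norm_mult_ineq)

lemma tensor_lmult_of: "tensor_lmult a (b \<otimes>\<^sub>p c) = (a * b) \<otimes>\<^sub>p c"
  by (simp add: tensor_lmult_def ptensor_lift_of bounded_cbilinear_lmult)

lemma tensor_rmult_of: "tensor_rmult (b \<otimes>\<^sub>p c) a = b \<otimes>\<^sub>p (c * a)"
  by (simp add: tensor_rmult_def ptensor_lift_of bounded_cbilinear_rmult)

lemma product_map_of: "product_map (b \<otimes>\<^sub>p c) = b * c"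
  by (simp add: product_map_def ptensor_lift_of bounded_cbilinear_times)

lemma bounded_clinear_tensor_lmult: "bounded_clinear (tensor_lmult a)"
  unfolding tensor_lmult_def[abs_def]
  by (rule bounded_clinear_ptensor_lift[OF bounded_cbilinear_lmult])

lemma bounded_clinear_tensor_rmult: "bounded_clinear (\<lambda>t. tensor_rmult t a)"
  unfolding tensor_rmult_def by (rule bounded_clinear_ptensor_lift[OF bounded_cbilinear_rmult])

lemma bounded_clinear_product_map: "bounded_clinear product_map"
  unfolding product_map_def by (rule bounded_clinear_ptensor_lift[OF bounded_cbilinear_times])

lemma bounded_clinear_times_left: "bounded_clinear (\<lambda>x. (a::'a::complex_banach_algebra) * x)"
  by (rule bounded_clinearI[of _ "norm a"])
    (simp_all add: distrib_left scaleC_mult_right norm_mult_ineq mult.commute[of "norm _" "norm a"])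

lemma bounded_clinear_times_right: "bounded_clinear (\<lambda>x. x * (a::'a::complex_banach_algebra))"
  by (rule bounded_clinearI[of _ "norm a"]) (simp_all add: distrib_right scaleC_mult_left norm_mult_ineq)

text \<open>
  For a bimodule \<open>X\<close> with left action \<open>l\<close> and right action \<open>r\<close>, the actions on \<open>X\<^sup>*\<close> are
  \<open>(a \<cdot> f)(x) = f(x \<cdot> a)\<close> and \<open>(f \<cdot> a)(x) = f(a \<cdot> x)\<close>. The actions on \<open>X\<^sup>*\<^sup>*\<close> are
  obtained by iterating this construction.
\<close>

definition dual_lmult :: "('x \<Rightarrow> 'a \<Rightarrow> 'x) \<Rightarrow> 'a \<Rightarrow> 'x::complex_normed_vector cdual \<Rightarrow> 'x cdual"
  where "dual_lmult r a f = dual_map (\<lambda>x. r x a) f"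

definition dual_rmult :: "('a \<Rightarrow> 'x \<Rightarrow> 'x) \<Rightarrow> 'x::complex_normed_vector cdual \<Rightarrow> 'a \<Rightarrow> 'x cdual"
  where "dual_rmult l f a = dual_map (\<lambda>x. l a x) f"

definition bidual_lmult :: "('a \<Rightarrow> 'x \<Rightarrow> 'x) \<Rightarrow> 'a \<Rightarrow> 'x::complex_normed_vector cdual cdual \<Rightarrow> 'x cdual cdual"
  where "bidual_lmult l = dual_lmult (dual_rmult l)"

definition bidual_rmult :: "('x \<Rightarrow> 'a \<Rightarrow> 'x) \<Rightarrow> 'x::complex_normed_vector cdual cdual \<Rightarrow> 'a \<Rightarrow> 'x cdual cdual"
  where "bidual_rmult r = dual_rmult (dual_lmult r)"

lemma norm_dual_map_le:
  assumes "bounded_clinear T" "K \<ge> 0" "\<And>x. norm (T x) \<le> norm x * K"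
  shows "norm (dual_map T f) \<le> norm f * K"
proof (rule norm_cdual_le)
  fix x
  have "norm (cdual_apply f (T x)) \<le> norm f * norm (T x)" by (rule norm_cdual_apply)
  also have "\<dots> \<le> norm f * (norm x * K)" by (intro mult_left_mono assms norm_ge_zero)
  finally show "norm (cdual_apply (dual_map T f) x) \<le> norm f * K * norm x"
    using assms(1) by (simp add: cdual_apply_dual_map ac_simps)
qed (use assms in simp)

lemma bounded_clinear_dual_map:
  assumes "bounded_clinear T" shows "bounded_clinear (dual_map T)"
proof -
  obtain K where K: "K \<ge> 0" "\<And>x. norm (T x) \<le> norm x * K"
    using bounded_clinear_bound[OF assms] by blast
  show ?thesis
    using norm_dual_map_le[OF assms K]
    by (intro bounded_clinearI[of _ K] cdual_eqI)
      (auto simp: cdual_apply_dual_map[OF assms] plus_cdual.rep_eq scaleC_cdual.rep_eq)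
qed

lemma cdual_apply_bidual_lmult:
  assumes "bounded_clinear (l a)"
  shows "cdual_apply (bidual_lmult l a M) f = cdual_apply M (dual_map (l a) f)"
  using bounded_clinear_dual_map[OF assms]
  by (simp add: bidual_lmult_def dual_lmult_def dual_rmult_def[abs_def] cdual_apply_dual_map)

lemma cdual_apply_bidual_rmult:
  assumes "bounded_clinear (\<lambda>x. r x a)"
  shows "cdual_apply (bidual_rmult r M a) f = cdual_apply M (dual_map (\<lambda>x. r x a) f)"
  using bounded_clinear_dual_map[OF assms]
  by (simp add: bidual_rmult_def dual_rmult_def dual_lmult_def[abs_def] cdual_apply_dual_map)

definition directed_set :: "'i set \<Rightarrow> ('i \<Rightarrow> 'i \<Rightarrow> bool) \<Rightarrow> bool"
  where "directed_set D le \<longleftrightarrow> D \<noteq> {} \<and> (\<forall>i\<in>D. le i i) \<and>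
    (\<forall>i\<in>D. \<forall>j\<in>D. \<forall>k\<in>D. le i j \<longrightarrow> le j k \<longrightarrow> le i k) \<and>
    (\<forall>i\<in>D. \<forall>j\<in>D. \<exists>k\<in>D. le i k \<and> le j k)"

definition net_tendsto :: "'i set \<Rightarrow> ('i \<Rightarrow> 'i \<Rightarrow> bool) \<Rightarrow> ('i \<Rightarrow> 'x::real_normed_vector) \<Rightarrow> 'x \<Rightarrow> bool"
  where "net_tendsto D le x l \<longleftrightarrow>
    (\<forall>e>0. \<exists>i\<in>D. \<forall>j\<in>D. le i j \<longrightarrow> norm (x j - l) < e)"

definition strong_pseudo_amenable_net ::
    "'i set \<Rightarrow> ('i \<Rightarrow> 'i \<Rightarrow> bool) \<Rightarrow> ('i \<Rightarrow> ('a::complex_banach_algebra, 'a) ptensor cdual cdual) \<Rightarrow> bool"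
  where "strong_pseudo_amenable_net D le m \<longleftrightarrow> directed_set D le \<and>
    (\<forall>a. net_tendsto D le
       (\<lambda>i. bidual_lmult tensor_lmult a (m i) - bidual_rmult tensor_rmult (m i) a) 0) \<and>
    (\<forall>i\<in>D. \<forall>a.
       bidual_lmult (*) a (dual_map (dual_map product_map) (m i)) =
       bidual_rmult (*) (dual_map (dual_map product_map) (m i)) a) \<and>
    (\<forall>a. net_tendsto D le (\<lambda>i. bidual_rmult (*) (dual_map (dual_map product_map) (m i)) a)
       (canonical_embedding a))"

text \<open>
  HOL cannot quantify over the type of the index set of a net inside a definition, so the index
  sets are taken from one fixed type. This type is large enough: by
  \<open>strong_pseudo_amenable_if_net\<close> below, nets over arbitrary index types give nothing more.
\<close>

definition strong_pseudo_amenable :: "'a::complex_banach_algebra itself \<Rightarrow> bool"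
  where "strong_pseudo_amenable (_ :: 'a itself) \<longleftrightarrow>
    (\<exists>(D :: (('a, 'a) ptensor cdual cdual \<times> ('a, 'a) ptensor cdual cdual set) set) le
      (m :: _ \<Rightarrow> ('a, 'a) ptensor cdual cdual). strong_pseudo_amenable_net D le m)"

text \<open>The equivalent formulation with filters in place of nets.\<close>

definition strong_pseudo_amenable_filter ::
    "('a::complex_banach_algebra, 'a) ptensor cdual cdual filter \<Rightarrow> bool"
  where "strong_pseudo_amenable_filter F \<longleftrightarrow> F \<noteq> bot \<and>
    (\<forall>a. ((\<lambda>m. bidual_lmult tensor_lmult a m - bidual_rmult tensor_rmult m a) \<longlongrightarrow> 0) F) \<and>
    (\<forall>\<^sub>F m in F. \<forall>a.
       bidual_lmult (*) a (dual_map (dual_map product_map) m) =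
       bidual_rmult (*) (dual_map (dual_map product_map) m) a) \<and>
    (\<forall>a. ((\<lambda>m. bidual_rmult (*) (dual_map (dual_map product_map) m) a)
            \<longlongrightarrow> canonical_embedding a) F)"

lemma net_filter:
  fixes m :: "'i \<Rightarrow> 'x"
  assumes D: "directed_set D le"
  obtains F where "F \<noteq> bot"
    "\<And>P. eventually P F \<longleftrightarrow> (\<exists>i\<in>D. \<forall>j\<in>D. le i j \<longrightarrow> P (m j))"
proof -
  have ne: "D \<noteq> {}" and refl: "\<And>i. i \<in> D \<Longrightarrow> le i i"
    and trans: "\<And>i j k. i \<in> D \<Longrightarrow> j \<in> D \<Longrightarrow> k \<in> D \<Longrightarrow> le i j \<Longrightarrow> le j k \<Longrightarrow> le i k"
    and dir: "\<And>i j. i \<in> D \<Longrightarrow> j \<in> D \<Longrightarrow> \<exists>k\<in>D. le i k \<and> le j k"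
    using D unfolding directed_set_def by metis+
  define F where "F = (INF i\<in>D. principal (m ` {j\<in>D. le i j}))"
  have ev: "eventually P F \<longleftrightarrow> (\<exists>i\<in>D. \<forall>j\<in>D. le i j \<longrightarrow> P (m j))" for P
  proof -
    have "eventually P F \<longleftrightarrow> (\<exists>i\<in>D. eventually P (principal (m ` {j\<in>D. le i j})))"
      unfolding F_def
    proof (rule eventually_INF_base[OF ne])
      fix i j assume ij: "i \<in> D" "j \<in> D"
      then obtain k where k: "k \<in> D" "le i k" "le j k" using dir by metis
      then have "{l\<in>D. le k l} \<subseteq> {l\<in>D. le i l} \<and> {l\<in>D. le k l} \<subseteq> {l\<in>D. le j l}"
        using trans[OF ij(1) k(1) _ k(2)] trans[OF ij(2) k(1) _ k(3)] by auto
      then have "m ` {l\<in>D. le k l} \<subseteq> m ` {l\<in>D. le i l} \<inter> m ` {l\<in>D. le j l}" by blast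
      then have "principal (m ` {l\<in>D. le k l}) \<le>
          inf (principal (m ` {l\<in>D. le i l})) (principal (m ` {l\<in>D. le j l}))"
        by (simp only: inf_principal principal_le_iff)
      then show "\<exists>k\<in>D. principal (m ` {l\<in>D. le k l}) \<le>
          inf (principal (m ` {l\<in>D. le i l})) (principal (m ` {l\<in>D. le j l}))"
        using k(1) by (rule bexI)
    qed
    then show ?thesis by (auto simp: eventually_principal)
  qed
  have "\<not> eventually (\<lambda>_. False) F"
    unfolding ev using refl by blast
  then show thesis using that[of F] ev by (simp add: trivial_limit_def)
qed

lemma filter_if_net:
  fixes m :: "'i \<Rightarrow> ('a::complex_banach_algebra, 'a) ptensor cdual cdual"
  assumes m: "strong_pseudo_amenable_net D le m"
  shows "\<exists>F :: ('a, 'a) ptensor cdual cdual filter. strong_pseudo_amenable_filter F"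
proof -
  have D: "directed_set D le" using m by (simp add: strong_pseudo_amenable_net_def)
  obtain F where F: "F \<noteq> bot" and ev: "\<And>P. eventually P F \<longleftrightarrow> (\<exists>i\<in>D. \<forall>j\<in>D. le i j \<longrightarrow> P (m j))"
    using net_filter[OF D] by metis
  have "D \<noteq> {}" using D by (simp add: directed_set_def)
  then show ?thesis
    using F m unfolding strong_pseudo_amenable_filter_def strong_pseudo_amenable_net_def
    by (intro exI[of _ F] conjI) (simp_all add: tendsto_iff dist_norm ev net_tendsto_def, blast)
qed

lemma strong_pseudo_amenable_if_filter:
  fixes F :: "('a::complex_banach_algebra, 'a) ptensor cdual cdual filter"
  assumes "strong_pseudo_amenable_filter F"
  shows "strong_pseudo_amenable TYPE('a)"
proof -
  have F: "F \<noteq> bot"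
    and 1: "\<And>a. ((\<lambda>m. bidual_lmult tensor_lmult a m - bidual_rmult tensor_rmult m a) \<longlongrightarrow> 0) F"
    and 2: "\<forall>\<^sub>F m in F. \<forall>a.
         bidual_lmult (*) a (dual_map (dual_map product_map) m) =
         bidual_rmult (*) (dual_map (dual_map product_map) m) a"
    and 3: "\<And>a. ((\<lambda>m. bidual_rmult (*) (dual_map (dual_map product_map) m) a)
              \<longlongrightarrow> canonical_embedding a) F"
    using assms unfolding strong_pseudo_amenable_filter_def by auto
  define C where "C = {m :: ('a, 'a) ptensor cdual cdual. \<forall>a.
         bidual_lmult (*) a (dual_map (dual_map product_map) m) =
         bidual_rmult (*) (dual_map (dual_map product_map) m) a}"
  define D where "D = {(m, S). m \<in> S \<and> S \<subseteq> C \<and> (\<forall>\<^sub>F x in F. x \<in> S)}"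
  define le where "le = (\<lambda>(p :: ('a, 'a) ptensor cdual cdual \<times> ('a, 'a) ptensor cdual cdual set)
    (q :: ('a, 'a) ptensor cdual cdual \<times> ('a, 'a) ptensor cdual cdual set). snd q \<subseteq> snd p)"
  have ne: "\<exists>x. x \<in> S" if "\<forall>\<^sub>F x in F. x \<in> S" for S
    using eventually_happens'[OF F that] .
  have C: "\<forall>\<^sub>F x in F. x \<in> C" using 2 by (simp add: C_def)
  have tail: "\<exists>p\<in>D. \<forall>q\<in>D. le p q \<longrightarrow> P (fst q)" if P: "\<forall>\<^sub>F x in F. P x" for P
  proof -
    define S where "S = {x. P x} \<inter> C"
    have S: "\<forall>\<^sub>F x in F. x \<in> S"
      using P C by eventually_elim (auto simp: S_def)
    then obtain x where "x \<in> S" using ne by blast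
    then have "(x, S) \<in> D" using S by (auto simp: D_def S_def)
    moreover have "P (fst q)" if "q \<in> D" "le (x, S) q" for q
      using that by (auto simp: D_def le_def S_def)
    ultimately show ?thesis by blast
  qed
  have "directed_set D le"
    unfolding directed_set_def
  proof (intro conjI ballI impI)
    show "D \<noteq> {}" using ne[OF C] C by (auto simp: D_def)
    fix p q assume pq: "p \<in> D" "q \<in> D"
    then have S: "\<forall>\<^sub>F x in F. x \<in> snd p \<inter> snd q"
      by (auto simp: D_def intro: eventually_conj)
    then obtain x where "x \<in> snd p \<inter> snd q" using ne by blast
    then have "(x, snd p \<inter> snd q) \<in> D" using S pq by (auto simp: D_def)
    then show "\<exists>k\<in>D. le p k \<and> le q k" by (rule bexI[rotated]) (auto simp: le_def)
  qed (auto simp: le_def)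
  moreover have "\<forall>p\<in>D. fst p \<in> C" by (auto simp: D_def)
  ultimately have "strong_pseudo_amenable_net D le fst"
    unfolding strong_pseudo_amenable_net_def net_tendsto_def
    using 1 3 by (auto simp: C_def tendsto_iff dist_norm intro!: tail simp del: split_paired_Ex split_paired_All)
  then show ?thesis unfolding strong_pseudo_amenable_def by (intro exI)
qed

lemma strong_pseudo_amenable_if_net:
  fixes m :: "'i \<Rightarrow> ('a::complex_banach_algebra, 'a) ptensor cdual cdual"
  assumes "strong_pseudo_amenable_net D le m"
  shows "strong_pseudo_amenable TYPE('a)"
  using filter_if_net[OF assms] strong_pseudo_amenable_if_filter by blast

lemma strong_pseudo_amenable_iff_filter:
  "strong_pseudo_amenable TYPE('a::complex_banach_algebra) \<longleftrightarrow>
    (\<exists>F :: ('a, 'a) ptensor cdual cdual filter. strong_pseudo_amenable_filter F)"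
  using filter_if_net strong_pseudo_amenable_if_filter
  unfolding strong_pseudo_amenable_def by metis


section \<open>The algebra \<open>UP(I, A)\<close>\<close>

text \<open>
  The index set \<open>I\<close> is a linearly ordered type. The norm of a matrix is the sum of the norms of
  its entries.
\<close>

typedef (overloaded) ('i, 'a) up =
  "{m :: 'i::linorder \<Rightarrow> 'i \<Rightarrow> 'a::complex_banach_algebra.
     (\<forall>i j. i > j \<longrightarrow> m i j = 0) \<and> (\<lambda>(i, j). norm (m i j)) summable_on UNIV}"
  morphisms up_entry Abs_up
  by (rule exI[of _ "\<lambda>_ _. 0"]) (simp add: case_prod_unfold)

setup_lifting type_definition_up

lemma up_entry_below: "i > j \<Longrightarrow> up_entry x i j = 0"
  using up_entry[of x] by auto

lemma up_entry_summable: "(\<lambda>(i, j). norm (up_entry x i j)) summable_on UNIV"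
  using up_entry[of x] by auto

lemma up_eqI: "(\<And>i j. up_entry x i j = up_entry y i j) \<Longrightarrow> x = y"
  by (metis up_entry_inject ext)

lemma up_product_dominated:
  fixes x y :: "('i::linorder, 'a::complex_banach_algebra) up"
  defines "G \<equiv> \<lambda>((i, j), k). norm (up_entry x i k) * norm (up_entry y k j)"
  shows "G summable_on UNIV"
    and "infsum G UNIV \<le>
      (\<Sum>\<^sub>\<infinity>(i, j). norm (up_entry x i j)) * (\<Sum>\<^sub>\<infinity>(i, j). norm (up_entry y i j))"
proof -
  define f g where "f = (\<lambda>(i, j). norm (up_entry x i j))" and "g = (\<lambda>(i, j). norm (up_entry y i j))"
  define P where "P = (\<lambda>(p, q). f p * g q)"
  define h where "h = (\<lambda>((i :: 'i, j :: 'i), k :: 'i). ((i, k), (k, j)))"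
  have f: "f summable_on UNIV" "f p \<ge> 0" and g: "g summable_on UNIV" "g p \<ge> 0" for p
    using up_entry_summable[of x] up_entry_summable[of y] by (auto simp: f_def g_def split: prod.split)
  have "(\<lambda>r. norm (P r)) summable_on (UNIV \<times> UNIV)"
    by (rule Infinite_Sum.abs_summable_on_Sigma_iff[THEN iffD2])
      (use f g in \<open>auto simp: P_def abs_mult infsum_cmult_right' infsum_nonneg
         intro!: summable_on_cmult_right summable_on_cmult_left\<close>)
  then have P: "P summable_on (UNIV \<times> UNIV)"
    by (simp add: abs_summable_summable)
  have P_pos: "P p \<ge> 0" for p using f g by (auto simp: P_def split: prod.split)
  have sumP: "infsum P UNIV = infsum f UNIV * infsum g UNIV"
    using infsum_Sigma_banach[OF P] by (simp add: P_def infsum_cmult_right' infsum_cmult_left')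
  have inj: "inj h" by (auto simp: inj_def h_def)
  have G: "G = P \<circ> h" by (auto simp: fun_eq_iff G_def P_def h_def f_def g_def)
  have Ph: "P summable_on range h"
    by (rule summable_on_subset_banach[of _ UNIV]) (use P in auto)
  show "G summable_on UNIV"
    using Ph summable_on_reindex[OF inj, of P] by (simp add: G)
  have "infsum G UNIV = infsum P (range h)"
    by (simp add: G infsum_reindex[OF inj])
  also have "\<dots> \<le> infsum P UNIV"
    using P P_pos by (intro infsum_mono2 Ph) auto
  finally show "infsum G UNIV \<le>
      (\<Sum>\<^sub>\<infinity>(i, j). norm (up_entry x i j)) * (\<Sum>\<^sub>\<infinity>(i, j). norm (up_entry y i j))"
    by (simp add: sumP f_def g_def)
qed

lemma up_product_row:
  fixes x y :: "('i::linorder, 'a::complex_banach_algebra) up"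
  shows "(\<lambda>k. norm (up_entry x i k) * norm (up_entry y k j)) summable_on UNIV"
proof -
  have "(\<lambda>r. norm (case r of ((i, j), k) \<Rightarrow> norm (up_entry x i k) * norm (up_entry y k j)))
      summable_on (UNIV \<times> UNIV)"
    using up_product_dominated(1)[of x y] by (simp add: case_prod_unfold)
  from Infinite_Sum.abs_summable_on_Sigma_iff[THEN iffD1, OF this] show ?thesis
    by (auto simp: abs_mult)
qed

lemma up_product_abs_summable:
  "(\<lambda>k. norm (up_entry x i k * up_entry y k j)) summable_on UNIV"
  by (rule summable_on_comparison_test[OF up_product_row[of x i y j]]) (auto simp: norm_mult_ineq)

lemma up_product_summable:
  "(\<lambda>k. up_entry x i k * up_entry y k j) summable_on UNIV"
  by (rule abs_summable_summable[OF up_product_abs_summable])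

lemma up_product_norm:
  fixes x y :: "('i::linorder, 'a::complex_banach_algebra) up"
  defines "N \<equiv> \<lambda>(i, j). norm (\<Sum>\<^sub>\<infinity>k. up_entry x i k * up_entry y k j)"
  shows "N summable_on UNIV"
    and "infsum N UNIV \<le>
      (\<Sum>\<^sub>\<infinity>(i, j). norm (up_entry x i j)) * (\<Sum>\<^sub>\<infinity>(i, j). norm (up_entry y i j))"
proof -
  define G where "G = (\<lambda>((i, j), k). norm (up_entry x i k) * norm (up_entry y k j))"
  have G: "G summable_on (UNIV \<times> UNIV)"
    using up_product_dominated(1)[of x y] by (simp add: G_def)
  define R where "R = (\<lambda>p. \<Sum>\<^sub>\<infinity>k. G (p, k))"
  have R: "R summable_on UNIV"
    unfolding R_def using summable_on_Sigma_banach[of "\<lambda>p k. G (p, k)" UNIV "\<lambda>_. UNIV"] G by simp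
  have NR: "N p \<le> R p" for p
  proof -
    obtain i j where p: "p = (i, j)" by (cases p)
    have "N p \<le> (\<Sum>\<^sub>\<infinity>k. norm (up_entry x i k * up_entry y k j))"
      by (simp add: N_def p norm_infsum_bound up_product_abs_summable)
    also have "\<dots> \<le> (\<Sum>\<^sub>\<infinity>k. norm (up_entry x i k) * norm (up_entry y k j))"
      by (rule infsum_mono[OF up_product_abs_summable up_product_row]) (simp add: norm_mult_ineq)
    finally show ?thesis by (simp add: R_def G_def p)
  qed
  show N: "N summable_on UNIV"
    by (rule summable_on_comparison_test[OF R NR]) (auto simp: N_def)
  have "infsum N UNIV \<le> infsum R UNIV"
    by (rule infsum_mono[OF N R NR])
  also have "\<dots> = infsum G UNIV"
    unfolding R_def using infsum_Sigma_banach[OF G] by simp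
  also have "\<dots> \<le> (\<Sum>\<^sub>\<infinity>(i, j). norm (up_entry x i j)) * (\<Sum>\<^sub>\<infinity>(i, j). norm (up_entry y i j))"
    unfolding G_def by (rule up_product_dominated(2))
  finally show "infsum N UNIV \<le>
      (\<Sum>\<^sub>\<infinity>(i, j). norm (up_entry x i j)) * (\<Sum>\<^sub>\<infinity>(i, j). norm (up_entry y i j))" .
qed

lemma up_add_summable:
  assumes "(\<lambda>(i, j). norm (f i j :: 'a::real_normed_vector)) summable_on UNIV"
    "(\<lambda>(i, j). norm (g i j)) summable_on UNIV"
  shows "(\<lambda>(i, j). norm (f i j + g i j)) summable_on UNIV"
    and "(\<Sum>\<^sub>\<infinity>(i, j). norm (f i j + g i j)) \<le>
      (\<Sum>\<^sub>\<infinity>(i, j). norm (f i j)) + (\<Sum>\<^sub>\<infinity>(i, j). norm (g i j))"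
proof -
  have S: "(\<lambda>p. (case p of (i, j) \<Rightarrow> norm (f i j)) + (case p of (i, j) \<Rightarrow> norm (g i j))) summable_on UNIV"
    by (rule summable_on_add[OF assms])
  show *: "(\<lambda>(i, j). norm (f i j + g i j)) summable_on UNIV"
    by (rule summable_on_comparison_test[OF S]) (auto simp: norm_triangle_ineq)
  show "(\<Sum>\<^sub>\<infinity>(i, j). norm (f i j + g i j)) \<le>
      (\<Sum>\<^sub>\<infinity>(i, j). norm (f i j)) + (\<Sum>\<^sub>\<infinity>(i, j). norm (g i j))"
    unfolding infsum_add[OF assms, symmetric]
    by (rule infsum_mono[OF * S]) (auto simp: norm_triangle_ineq)
qed

instantiation up :: (linorder, complex_banach_algebra) complex_normed_vector
begin

lift_definition zero_up :: "('a, 'b) up" is "\<lambda>_ _. 0" by (simp add: case_prod_unfold)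
lift_definition plus_up :: "('a, 'b) up \<Rightarrow> ('a, 'b) up \<Rightarrow> ('a, 'b) up"
  is "\<lambda>x y i j. x i j + y i j"
  by (simp add: up_add_summable(1))
lift_definition uminus_up :: "('a, 'b) up \<Rightarrow> ('a, 'b) up"
  is "\<lambda>x i j. - x i j" by simp
lift_definition minus_up :: "('a, 'b) up \<Rightarrow> ('a, 'b) up \<Rightarrow> ('a, 'b) up"
  is "\<lambda>x y i j. x i j - y i j"
  using up_add_summable(1)[of _ "\<lambda>i j. - _ i j"] by auto
lift_definition scaleC_up :: "complex \<Rightarrow> ('a, 'b) up \<Rightarrow> ('a, 'b) up"
  is "\<lambda>c x i j. c *\<^sub>C x i j"
  by (auto simp: norm_scaleC case_prod_unfold intro: summable_on_cmult_right)
lift_definition norm_up :: "('a, 'b) up \<Rightarrow> real"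
  is "\<lambda>x. \<Sum>\<^sub>\<infinity>(i, j). norm (x i j)" .
definition scaleR_up :: "real \<Rightarrow> ('a, 'b) up \<Rightarrow> ('a, 'b) up"
  where "scaleR_up r x = complex_of_real r *\<^sub>C x"
definition dist_up :: "('a, 'b) up \<Rightarrow> ('a, 'b) up \<Rightarrow> real"
  where "dist_up x y = norm (x - y)"
definition sgn_up :: "('a, 'b) up \<Rightarrow> ('a, 'b) up"
  where "sgn_up x = scaleR (inverse (norm x)) x"
definition uniformity_up :: "(('a, 'b) up \<times> ('a, 'b) up) filter"
  where "uniformity_up = (INF e\<in>{0 <..}. principal {(x, y). dist x y < e})"
definition open_up :: "('a, 'b) up set \<Rightarrow> bool"
  where "open_up S = (\<forall>x\<in>S. \<forall>\<^sub>F (x', y) in uniformity. x' = x \<longrightarrow> y \<in> S)"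

instance
proof
  fix x y z :: "('a, 'b) up" and c d :: complex and r s :: real
  note ops = zero_up.rep_eq plus_up.rep_eq uminus_up.rep_eq minus_up.rep_eq scaleC_up.rep_eq
    scaleC_add_left scaleC_add_right scaleC_scaleC scaleR_up_def
  show "x + y + z = x + (y + z)" "x + y = y + x" "0 + x = x" "- x + x = 0" "x - y = x + - y"
    "c *\<^sub>C (x + y) = c *\<^sub>C x + c *\<^sub>C y" "(c + d) *\<^sub>C x = c *\<^sub>C x + d *\<^sub>C x"
    "c *\<^sub>C d *\<^sub>C x = (c * d) *\<^sub>C x"
    "r *\<^sub>R (x + y) = r *\<^sub>R x + r *\<^sub>R y" "(r + s) *\<^sub>R x = r *\<^sub>R x + s *\<^sub>R x"
    "r *\<^sub>R s *\<^sub>R x = (r * s) *\<^sub>R x" "1 *\<^sub>R x = x"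
    by (rule up_eqI; simp add: ops add.assoc add.commute)+
  show "complex_of_real r *\<^sub>C x = r *\<^sub>R x" by (rule scaleR_up_def[symmetric])
  show "dist x y = norm (x - y)" by (rule dist_up_def)
  show "sgn x = scaleR (inverse (norm x)) x" by (rule sgn_up_def)
  show "uniformity = (INF e\<in>{0<..}. principal {(x, y :: ('a, 'b) up). dist x y < e})"
    by (rule uniformity_up_def)
  show "open S = (\<forall>x\<in>S. \<forall>\<^sub>F (x', y) in uniformity. x' = x \<longrightarrow> y \<in> S)" for S :: "('a, 'b) up set"
    by (rule open_up_def)
  show "norm (x + y) \<le> norm x + norm y"
    unfolding norm_up.rep_eq plus_up.rep_eq
    by (intro up_add_summable(2) up_entry_summable)
  show "(norm x = 0) = (x = 0)"
  proof
    assume "norm x = 0"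
    then have "(case (i, j) of (i, j) \<Rightarrow> norm (up_entry x i j)) = 0" for i j
      by (intro nonneg_infsum_le_0D[OF _ up_entry_summable[of x]]) (auto simp: norm_up.rep_eq)
    then show "x = 0" by (intro up_eqI) (simp add: zero_up.rep_eq)
  qed (simp add: norm_up.rep_eq zero_up.rep_eq case_prod_unfold)
  show norm_C: "norm (c *\<^sub>C x) = cmod c * norm x" for c
    by (simp add: norm_up.rep_eq scaleC_up.rep_eq norm_scaleC case_prod_unfold infsum_cmult_right')
  show "norm (r *\<^sub>R x) = \<bar>r\<bar> * norm x" by (simp add: scaleR_up_def norm_C)
qed

end

lemma up_finite_sum_le_norm:
  "finite S \<Longrightarrow> (\<Sum>(i, j)\<in>S. norm (up_entry x i j)) \<le> norm x"
  unfolding norm_up.rep_eq by (rule finite_sum_le_infsum[OF up_entry_summable]) auto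

lemma norm_up_entry_le: "norm (up_entry x i j) \<le> norm x"
  using up_finite_sum_le_norm[of "{(i, j)}" x] by simp

instance up :: (linorder, complex_banach_algebra) cbanach
proof
  fix X :: "nat \<Rightarrow> ('a, 'b) up" assume X: "Cauchy X"
  have "Cauchy (\<lambda>n. up_entry (X n) i j)" for i j
  proof (rule CauchyI)
    fix e :: real assume "e > 0"
    then obtain N where N: "\<And>m n. m \<ge> N \<Longrightarrow> n \<ge> N \<Longrightarrow> norm (X m - X n) < e"
      using CauchyD[OF X] by blast
    have "norm (up_entry (X m) i j - up_entry (X n) i j) < e" if "m \<ge> N" "n \<ge> N" for m n
      using norm_up_entry_le[of "X m - X n" i j] N[OF that] by (simp add: minus_up.rep_eq)
    then show "\<exists>N. \<forall>m\<ge>N. \<forall>n\<ge>N. norm (up_entry (X m) i j - up_entry (X n) i j) < e" by blast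
  qed
  then have "\<exists>l. (\<lambda>n. up_entry (X n) i j) \<longlonglongrightarrow> l" for i j
    by (simp add: Cauchy_convergent_iff convergent_def)
  then obtain L where L: "\<And>i j. (\<lambda>n. up_entry (X n) i j) \<longlonglongrightarrow> L i j" by metis
  have bound: "\<exists>N. \<forall>n\<ge>N. \<forall>S. finite S \<longrightarrow> (\<Sum>(i, j)\<in>S. norm (L i j - up_entry (X n) i j)) \<le> e"
    if "e > 0" for e
  proof -
    obtain N where N: "\<And>m n. m \<ge> N \<Longrightarrow> n \<ge> N \<Longrightarrow> norm (X m - X n) < e"
      using CauchyD[OF X \<open>e > 0\<close>] by blast
    have "(\<Sum>(i, j)\<in>S. norm (L i j - up_entry (X n) i j)) \<le> e" if "n \<ge> N" "finite S" for n S
    proof (rule LIMSEQ_le_const2)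
      show "(\<lambda>m. \<Sum>(i, j)\<in>S. norm (up_entry (X m) i j - up_entry (X n) i j))
          \<longlonglongrightarrow> (\<Sum>(i, j)\<in>S. norm (L i j - up_entry (X n) i j))"
        unfolding case_prod_unfold by (intro tendsto_intros L)
      show "\<exists>M. \<forall>m\<ge>M. (\<Sum>(i, j)\<in>S. norm (up_entry (X m) i j - up_entry (X n) i j)) \<le> e"
      proof (intro exI[of _ N] allI impI)
        fix m assume "m \<ge> N"
        then show "(\<Sum>(i, j)\<in>S. norm (up_entry (X m) i j - up_entry (X n) i j)) \<le> e"
          using up_finite_sum_le_norm[OF \<open>finite S\<close>, of "X m - X n"] N[of m n] \<open>n \<ge> N\<close>
          by (simp add: minus_up.rep_eq)
      qed
    qed
    then show ?thesis by blast
  qed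
  have summ: "(\<lambda>(i, j). norm (L i j - up_entry (X n) i j)) summable_on UNIV"
    if "\<And>S. finite S \<Longrightarrow> (\<Sum>(i, j)\<in>S. norm (L i j - up_entry (X n) i j)) \<le> e" for n e
    by (rule nonneg_bdd_above_summable_on) (auto intro!: bdd_aboveI2[where M = e] that)
  obtain N where N: "\<And>S. finite S \<Longrightarrow> (\<Sum>(i, j)\<in>S. norm (L i j - up_entry (X N) i j)) \<le> 1"
    using bound[of 1] by auto
  have "(\<lambda>(i, j). norm ((L i j - up_entry (X N) i j) + up_entry (X N) i j)) summable_on UNIV"
    by (intro up_add_summable(1) summ[OF N] up_entry_summable)
  then have "(\<lambda>(i, j). norm (L i j)) summable_on UNIV" by simp
  moreover have "L i j = 0" if "i > j" for i j
    using LIMSEQ_unique[OF L[of i j]] that by (simp add: up_entry_below)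
  ultimately have L': "up_entry (Abs_up L) = L" by (simp add: Abs_up_inverse)
  have "X \<longlonglongrightarrow> Abs_up L"
  proof (rule LIMSEQ_I)
    fix e :: real assume "e > 0"
    then obtain N where
      N: "\<And>n S. n \<ge> N \<Longrightarrow> finite S \<Longrightarrow> (\<Sum>(i, j)\<in>S. norm (L i j - up_entry (X n) i j)) \<le> e / 2"
      using bound[of "e / 2"] by auto
    have "norm (X n - Abs_up L) < e" if "n \<ge> N" for n
    proof -
      have "norm (Abs_up L - X n) \<le> e / 2"
        unfolding norm_up.rep_eq minus_up.rep_eq L'
        by (rule infsum_le_finite_sums[OF summ[OF N[OF that]] N[OF that]])
      then show ?thesis using \<open>e > 0\<close> by (simp add: norm_minus_commute)
    qed
    then show "\<exists>N. \<forall>n\<ge>N. norm (X n - Abs_up L) < e" by blast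
  qed
  then show "convergent X" by (auto simp: convergent_def)
qed

lemma infsum_bl:
  "bounded_linear h \<Longrightarrow> f summable_on S \<Longrightarrow> (\<Sum>\<^sub>\<infinity>x\<in>S. h (f x)) = h (infsum f S)"
  using has_sum_bounded_linear[of h f S] by (metis has_sum_infsum infsumI)

instantiation up :: (linorder, complex_banach_algebra) complex_banach_algebra
begin

lift_definition times_up :: "('a, 'b) up \<Rightarrow> ('a, 'b) up \<Rightarrow> ('a, 'b) up"
  is "\<lambda>x y i j. \<Sum>\<^sub>\<infinity>k. x i k * y k j"
proof (intro conjI allI impI)
  fix x y :: "'a \<Rightarrow> 'a \<Rightarrow> 'b"
  assume x: "(\<forall>i j. j < i \<longrightarrow> x i j = 0) \<and> (\<lambda>(i, j). norm (x i j)) summable_on UNIV"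
    and y: "(\<forall>i j. j < i \<longrightarrow> y i j = 0) \<and> (\<lambda>(i, j). norm (y i j)) summable_on UNIV"
  show "(\<lambda>(i, j). norm (\<Sum>\<^sub>\<infinity>k. x i k * y k j)) summable_on UNIV"
    using up_product_norm(1)[of "Abs_up x" "Abs_up y"] x y by (simp add: Abs_up_inverse)
  fix i j :: 'a assume "j < i"
  then have "x i k * y k j = 0" for k
    using x y by (cases "k < i") auto
  then show "(\<Sum>\<^sub>\<infinity>k. x i k * y k j) = 0" by simp
qed

instance
proof
  fix x y z :: "('a, 'b) up" and c :: complex and r :: real
  note S = up_product_summable
  show "(x * y) * z = x * (y * z)"
  proof (rule up_eqI)
    fix i j
    let ?F = "\<lambda>l k. up_entry x i k * up_entry y k l * up_entry z l j"
    have y: "(\<lambda>(l, k). norm (up_entry y k l)) summable_on UNIV"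
      using summable_on_reindex_bij_betw[of prod.swap UNIV UNIV "\<lambda>(k, l). norm (up_entry y k l)"]
        up_entry_summable[of y] by (simp add: case_prod_unfold)
    have "(\<lambda>p. norm (case p of (l, k) \<Rightarrow> ?F l k)) summable_on UNIV"
    proof (rule summable_on_comparison_test[OF summable_on_cmult_right[OF y, of "norm x * norm z"]])
      fix p :: "'a \<times> 'a"
      obtain l k where p: "p = (l, k)" by (cases p)
      have "norm (?F l k) \<le> norm (up_entry x i k * up_entry y k l) * norm (up_entry z l j)"
        by (rule norm_mult_ineq)
      also have "\<dots> \<le> (norm (up_entry x i k) * norm (up_entry y k l)) * norm (up_entry z l j)"
        by (intro mult_right_mono norm_mult_ineq norm_ge_zero)
      also have "\<dots> \<le> (norm x * norm (up_entry y k l)) * norm z"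
        by (intro mult_mono norm_up_entry_le mult_nonneg_nonneg norm_ge_zero order_refl)
      finally show "norm (case p of (l, k) \<Rightarrow> ?F l k) \<le>
          norm x * norm z * (case p of (l, k) \<Rightarrow> norm (up_entry y k l))"
        by (simp add: p ac_simps)
    qed simp
    then have F: "(\<lambda>(l, k). ?F l k) summable_on (UNIV \<times> UNIV)"
      by (simp add: abs_summable_summable)
    have "up_entry (x * y * z) i j = (\<Sum>\<^sub>\<infinity>l. (\<Sum>\<^sub>\<infinity>k. up_entry x i k * up_entry y k l) * up_entry z l j)"
      by (simp add: times_up.rep_eq)
    also have "\<dots> = (\<Sum>\<^sub>\<infinity>l. \<Sum>\<^sub>\<infinity>k. ?F l k)"
      by (simp add: infsum_bl[OF bounded_linear_mult_left S, symmetric])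
    also have "\<dots> = (\<Sum>\<^sub>\<infinity>k. \<Sum>\<^sub>\<infinity>l. ?F l k)"
      by (rule infsum_swap_banach[OF F])
    also have "\<dots> = (\<Sum>\<^sub>\<infinity>k. up_entry x i k * (\<Sum>\<^sub>\<infinity>l. up_entry y k l * up_entry z l j))"
      by (simp add: mult.assoc infsum_bl[OF bounded_linear_mult_right S])
    finally show "up_entry (x * y * z) i j = up_entry (x * (y * z)) i j"
      by (simp add: times_up.rep_eq)
  qed
  show "(x + y) * z = x * z + y * z" "x * (y + z) = x * y + x * z"
    by (rule up_eqI; simp add: times_up.rep_eq plus_up.rep_eq distrib_left distrib_right infsum_add S)+
  have lin: "bounded_linear (\<lambda>x::'b. c *\<^sub>C x)" for c
    by (rule bounded_clinear_bounded_linear, rule bounded_clinearI[of _ "cmod c"])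
      (auto simp: scaleC_add_right scaleC_scaleC norm_scaleC mult.commute)
  note sc = infsum_bl[OF lin S]
  show left: "(c *\<^sub>C x) * y = c *\<^sub>C (x * y)" and right: "x * (c *\<^sub>C y) = c *\<^sub>C (x * y)" for c
    by (rule up_eqI; simp add: times_up.rep_eq scaleC_up.rep_eq scaleC_mult_left scaleC_mult_right sc)+
  show "(r *\<^sub>R x) * y = r *\<^sub>R (x * y)" "x * (r *\<^sub>R y) = r *\<^sub>R (x * y)"
    by (simp_all add: left right flip: scaleC_of_real)
  show "norm (x * y) \<le> norm x * norm y"
    unfolding norm_up.rep_eq times_up.rep_eq by (rule up_product_norm(2))
qed

end

end

theory Submission
  imports Defs
begin

text \<open>
  Let \<open>0\<close> be the least index. The corner entry \<open>x \<mapsto> x\<^sub>0\<^sub>0\<close> is a continuous homomorphism of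
  \<open>UP(I, A)\<close> onto \<open>A\<close>, and strong pseudo-amenability passes to quotients; if \<open>|I| = 1\<close>, the corner
  embedding \<open>A \<rightarrow> UP(I, A)\<close> is onto as well.

  Suppose there is an index \<open>j > 0\<close>, and let \<open>c \<in> A\<close> with \<open>\<phi>(c) = 1\<close>. Put \<open>\<psi>(x) = \<phi>(x\<^sub>0\<^sub>0)\<close>, a character,
  \<open>B(x \<otimes> y) = \<phi>(x\<^sub>0\<^sub>0) \<phi>(y\<^sub>0\<^sub>j)\<close> and \<open>a = c E\<^sub>0\<^sub>j\<close>. Then \<open>B(a \<cdot> t) = 0\<close> because \<open>(a x)\<^sub>0\<^sub>0 = c x\<^sub>j\<^sub>0 = 0\<close>,
  while \<open>B(t \<cdot> a) = \<psi>(\<pi>(t))\<close>. So \<open>a \<cdot> m - m \<cdot> a \<rightarrow> 0\<close> forces \<open>\<pi>\<^sup>*\<^sup>*(m)(\<psi>) \<rightarrow> 0\<close>, whereas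
  \<open>\<pi>\<^sup>*\<^sup>*(m) b \<rightarrow> b\<close> forces \<open>\<pi>\<^sup>*\<^sup>*(m)(\<psi>) \<rightarrow> 1\<close>.
\<close>

section \<open>Characters\<close>

lemma character_mult: "\<phi> \<in> characters \<Longrightarrow> \<phi> (x * y) = \<phi> x * \<phi> y"
  by (simp add: characters_def)

lemma character_clinear: "\<phi> \<in> characters \<Longrightarrow> clinear \<phi>"
  by (simp add: characters_def)

lemma character_eq_one:
  assumes "\<phi> \<in> characters"
  obtains c where "\<phi> c = 1"
proof -
  obtain x where "\<phi> x \<noteq> 0"
    using assms by (auto simp: characters_def)
  then have "\<phi> (inverse (\<phi> x) *\<^sub>C x) = 1"
    using clinear_scaleC[OF character_clinear[OF assms]] by (simp add: scaleC_complex_def)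
  then show thesis
    by (rule that)
qed

text \<open>If \<open>\<parallel>x\<parallel> < 1\<close> and \<open>\<phi>(x) = 1\<close>, apply \<open>\<phi>\<close> to the solution \<open>y\<close> of \<open>y = x + x y\<close>.\<close>

lemma character_neq_one:
  fixes \<phi> :: "'a::complex_banach_algebra \<Rightarrow> complex"
  assumes \<phi>: "\<phi> \<in> characters" and x: "norm x < 1"
  shows "\<phi> x \<noteq> 1"
proof
  assume 1: "\<phi> x = 1"
  \<comment> \<open>The affine map \<open>y \<mapsto> x + x * y\<close> contracts by the factor
    \<open>norm x\<close>; its fixed point replaces the Neumann series, since there may be no unit
    to invert \<open>1 - x\<close>.\<close>
  have "dist (x + x * y) (x + x * z) \<le> norm x * dist y z" for y z
    using norm_mult_ineq[of x "y - z"] by (simp add: dist_norm right_diff_distrib)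
  then have "\<exists>!y. x + x * y = y"
    using x by (intro banach_fix_type[of "norm x"]) auto
  then obtain y where "x + x * y = y"
    by blast
  then have "\<phi> y = \<phi> (x + x * y)"
    by simp
  also have "\<dots> = 1 + \<phi> y"
    using 1 by (simp add: clinear_add[OF character_clinear[OF \<phi>]] character_mult[OF \<phi>])
  finally show False
    by simp
qed

text \<open>Automatic continuity: if the bound failed at \<open>x\<close>, rescaling
  \<open>x\<close> by \<open>inverse (\<phi> x)\<close> would give an element of norm below 1 with
  value 1.\<close>

lemma norm_character_le:
  assumes \<phi>: "\<phi> \<in> characters"
  shows "norm (\<phi> x) \<le> norm x"
proof (rule ccontr)
  assume "\<not> norm (\<phi> x) \<le> norm x"
  then have less: "norm x < norm (\<phi> x)" and nz: "\<phi> x \<noteq> 0"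
    using norm_ge_zero[of x] by auto
  have "norm (inverse (\<phi> x) *\<^sub>C x) < 1"
    using less nz by (simp add: norm_scaleC norm_inverse norm_divide field_simps)
  moreover have "\<phi> (inverse (\<phi> x) *\<^sub>C x) = 1"
    using clinear_scaleC[OF character_clinear[OF \<phi>]] nz by (simp add: scaleC_complex_def)
  ultimately show False
    using character_neq_one[OF \<phi>] by blast
qed

lemma bounded_clinear_character: "\<phi> \<in> characters \<Longrightarrow> bounded_clinear \<phi>"
  using norm_character_le unfolding bounded_clinear_def
  by (auto simp: character_clinear intro!: exI[of _ 1])


section \<open>Quotients of strong pseudo-amenable algebras\<close>

lemma net_tendsto_bounded_clinear:
  assumes T: "bounded_clinear T" and x: "net_tendsto D le x l"
  shows "net_tendsto D le (\<lambda>i. T (x i)) (T l)"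
  unfolding net_tendsto_def
proof (intro allI impI)
  fix e :: real
  assume e: "e > 0"
  obtain K where K: "K > 0" "\<And>y. norm (T y) \<le> norm y * K"
    using bounded_linear.pos_bounded[OF bounded_clinear_bounded_linear[OF T]] by blast
  obtain i where i: "i \<in> D" "\<And>j. j \<in> D \<Longrightarrow> le i j \<Longrightarrow> norm (x j - l) < e / K"
    using x e K(1) unfolding net_tendsto_def by (metis divide_pos_pos)
  have "norm (T (x j) - T l) < e" if "j \<in> D" "le i j" for j
  proof -
    have "norm (T (x j) - T l) \<le> norm (x j - l) * K"
      using K(2)[of "x j - l"] by (simp add: clinear_diff[OF bounded_clinear_clinear[OF T]])
    also have "\<dots> < e"
      using i(2)[OF that] K(1) by (simp add: field_simps)
    finally show ?thesis .
  qed
  with i(1) show "\<exists>i\<in>D. \<forall>j\<in>D. le i j \<longrightarrow> norm (T (x j) - T l) < e"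
    by blast
qed

text \<open>Turns norm convergence in a bidual into scalar convergence at a fixed
  functional.\<close>

lemma bounded_clinear_apply: "bounded_clinear (\<lambda>F. cdual_apply F f)"
  by (rule bounded_clinearI[of _ "norm f"])
    (simp_all add: plus_cdual.rep_eq scaleC_cdual.rep_eq scaleC_complex_def norm_cdual_apply)

section \<open>Functoriality of biduals and of their module actions\<close>

lemma dual_map_compose:
  assumes "bounded_clinear S" "bounded_clinear T"
  shows "dual_map S (dual_map T f) = dual_map (\<lambda>x. T (S x)) f"
  by (rule cdual_eqI) (simp add: cdual_apply_dual_map assms bounded_clinear_compose)

lemma bidual_map_compose:
  assumes "bounded_clinear S" "bounded_clinear T"
  shows "dual_map (dual_map T) (dual_map (dual_map S) M) = dual_map (dual_map (\<lambda>x. T (S x))) M"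
  by (rule cdual_eqI)
    (simp add: cdual_apply_dual_map assms bounded_clinear_compose bounded_clinear_dual_map
      dual_map_compose)

text \<open>At a functional \<open>f\<close>, both sides are \<open>M\<close> applied to
  \<open>f\<close> composed with \<open>T\<close> after \<open>l a\<close>. The right-hand version
  below is analogous.\<close>

lemma bidual_lmult_equivariant:
  assumes T: "bounded_clinear T" and l: "bounded_clinear (l a)" and l': "bounded_clinear (l' b)"
    and eq: "\<And>x. T (l a x) = l' b (T x)"
  shows "bidual_lmult l' b (dual_map (dual_map T) M) = dual_map (dual_map T) (bidual_lmult l a M)"
  by (rule cdual_eqI)
    (simp add: cdual_apply_bidual_lmult l l' cdual_apply_dual_map bounded_clinear_dual_map T
      dual_map_compose eq)

lemma bidual_rmult_equivariant:
  assumes T: "bounded_clinear T" and r: "bounded_clinear (\<lambda>x. r x a)"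
    and r': "bounded_clinear (\<lambda>x. r' x b)" and eq: "\<And>x. T (r x a) = r' (T x) b"
  shows "bidual_rmult r' (dual_map (dual_map T) M) b = dual_map (dual_map T) (bidual_rmult r M a)"
  by (rule cdual_eqI)
    (simp add: cdual_apply_bidual_rmult r r' cdual_apply_dual_map bounded_clinear_dual_map T
      dual_map_compose eq)

lemma canonical_embedding_natural:
  assumes "bounded_clinear T"
  shows "dual_map (dual_map T) (canonical_embedding x) = canonical_embedding (T x)"
  by (rule cdual_eqI)
    (simp add: cdual_apply_dual_map assms bounded_clinear_dual_map canonical_embedding.rep_eq)

section \<open>The induced map on projective tensor squares\<close>

definition tensor_map :: "('a::complex_normed_vector \<Rightarrow> 'b::complex_normed_vector) \<Rightarrow>
    ('a, 'a) ptensor \<Rightarrow> ('b, 'b) ptensor"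
  where "tensor_map T = ptensor_lift (\<lambda>x y. T x \<otimes>\<^sub>p T y)"

lemma bounded_cbilinear_tensor_map:
  assumes "bounded_clinear T"
  shows "bounded_cbilinear (\<lambda>x y. T x \<otimes>\<^sub>p T y)"
proof -
  obtain K where K: "K \<ge> 0" "\<And>x. norm (T x) \<le> norm x * K"
    using bounded_clinear_bound[OF assms] by blast
  have T: "T (x + y) = T x + T y" "T (c *\<^sub>C x) = c *\<^sub>C T x" for x y c
    using bounded_clinear_clinear[OF assms] by (simp_all add: clinear_add clinear_scaleC)
  show ?thesis
  proof (rule bounded_cbilinearI)
    fix x y
    have "norm (T x \<otimes>\<^sub>p T y) \<le> norm (T x) * norm (T y)"
      by (rule norm_ptensor_of_le)
    also have "\<dots> \<le> (norm x * K) * (norm y * K)"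
      using K by (intro mult_mono) auto
    finally show "norm (T x \<otimes>\<^sub>p T y) \<le> norm x * norm y * (K * K)"
      by (simp add: ac_simps)
  qed (simp_all add: T ptensor_of_simps)
qed

lemma bounded_clinear_tensor_map: "bounded_clinear T \<Longrightarrow> bounded_clinear (tensor_map T)"
  unfolding tensor_map_def by (intro bounded_clinear_ptensor_lift bounded_cbilinear_tensor_map)

lemma tensor_map_of: "bounded_clinear T \<Longrightarrow> tensor_map T (x \<otimes>\<^sub>p y) = T x \<otimes>\<^sub>p T y"
  by (simp add: tensor_map_def ptensor_lift_of bounded_cbilinear_tensor_map)

context
  fixes \<theta> :: "'a::complex_banach_algebra \<Rightarrow> 'b::complex_banach_algebra"
  assumes \<theta>: "bounded_clinear \<theta>" and \<theta>_mult: "\<And>x y. \<theta> (x * y) = \<theta> x * \<theta> y"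
begin

text \<open>Both sides are bounded and linear in \<open>t\<close>, so \<open>ptensor_ext\<close>
  reduces the claim to elementary tensors, where it is multiplicativity of \<open>\<theta>\<close>.
  The next two lemmas follow the same pattern.\<close>

lemma tensor_map_lmult: "tensor_map \<theta> (tensor_lmult a t) = tensor_lmult (\<theta> a) (tensor_map \<theta> t)"
  by (rule fun_cong[where x = t], rule ptensor_ext)
    (simp_all add: bounded_clinear_compose bounded_clinear_tensor_map bounded_clinear_tensor_lmult
      tensor_map_of tensor_lmult_of \<theta> \<theta>_mult)

lemma tensor_map_rmult: "tensor_map \<theta> (tensor_rmult t a) = tensor_rmult (tensor_map \<theta> t) (\<theta> a)"
  by (rule fun_cong[where x = t], rule ptensor_ext)
    (simp_all add: bounded_clinear_compose[OF bounded_clinear_tensor_map bounded_clinear_tensor_rmult]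
      bounded_clinear_compose[OF bounded_clinear_tensor_rmult bounded_clinear_tensor_map]
      tensor_map_of tensor_rmult_of \<theta> \<theta>_mult)

lemma product_map_tensor_map: "product_map (tensor_map \<theta> t) = \<theta> (product_map t)"
  by (rule fun_cong[where x = t], rule ptensor_ext)
    (simp_all add: bounded_clinear_compose bounded_clinear_tensor_map bounded_clinear_product_map
      tensor_map_of product_map_of \<theta> \<theta>_mult)

text \<open>The net is pushed forward along the second transpose of
  \<open>tensor_map \<theta>\<close>. This map intertwines the actions of \<open>a\<close> and
  \<open>\<theta> a\<close> and is compatible with the product maps, so each condition on the old
  net is carried over by continuity.\<close>

lemma strong_pseudo_amenable_image:
  assumes surj: "surj \<theta>" and spa: "strong_pseudo_amenable TYPE('a)"
  shows "strong_pseudo_amenable TYPE('b)"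
proof -
  obtain D :: "(('a, 'a) ptensor cdual cdual \<times> ('a, 'a) ptensor cdual cdual set) set" and le
    and m :: "_ \<Rightarrow> ('a, 'a) ptensor cdual cdual"
    where m: "strong_pseudo_amenable_net D le m"
    using spa unfolding strong_pseudo_amenable_def by blast
  define T where "T = tensor_map \<theta>"
  have T: "bounded_clinear T"
    unfolding T_def by (rule bounded_clinear_tensor_map[OF \<theta>])
  define T2 where "T2 = dual_map (dual_map T)"
  define \<theta>2 where "\<theta>2 = dual_map (dual_map \<theta>)"
  have T2: "bounded_clinear T2" and \<theta>2: "bounded_clinear \<theta>2"
    unfolding T2_def \<theta>2_def by (intro bounded_clinear_dual_map T \<theta>)+
  have lT: "bidual_lmult tensor_lmult (\<theta> a) (T2 M) = T2 (bidual_lmult tensor_lmult a M)" for a M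
    unfolding T2_def
    by (intro bidual_lmult_equivariant T bounded_clinear_tensor_lmult) (simp add: T_def tensor_map_lmult)
  have rT: "bidual_rmult tensor_rmult (T2 M) (\<theta> a) = T2 (bidual_rmult tensor_rmult M a)" for a M
    unfolding T2_def
    by (intro bidual_rmult_equivariant T bounded_clinear_tensor_rmult) (simp add: T_def tensor_map_rmult)
  have l\<theta>: "bidual_lmult (*) (\<theta> a) (\<theta>2 M) = \<theta>2 (bidual_lmult (*) a M)" for a M
    unfolding \<theta>2_def by (intro bidual_lmult_equivariant \<theta> bounded_clinear_times_left) (rule \<theta>_mult)
  have r\<theta>: "bidual_rmult (*) (\<theta>2 M) (\<theta> a) = \<theta>2 (bidual_rmult (*) M a)" for a M
    unfolding \<theta>2_def by (intro bidual_rmult_equivariant \<theta> bounded_clinear_times_right) (rule \<theta>_mult)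
  have \<pi>: "dual_map (dual_map product_map) (T2 M) = \<theta>2 (dual_map (dual_map product_map) M)" for M
    unfolding T2_def \<theta>2_def
    by (simp add: bidual_map_compose T \<theta> bounded_clinear_product_map) (simp add: T_def product_map_tensor_map)
  \<comment> \<open>By surjectivity only elements \<open>\<theta> a\<close> have to be tested, which
    is the form the intertwining identities require.\<close>
  have all: "(\<forall>b. P b) \<longleftrightarrow> (\<forall>a. P (\<theta> a))" for P
    using surj by (metis surjD)
  have "strong_pseudo_amenable_net D le (\<lambda>i. T2 (m i))"
    unfolding strong_pseudo_amenable_net_def all lT rT \<pi> l\<theta> r\<theta>
  proof (intro conjI allI ballI)
    show "directed_set D le"
      using m by (simp add: strong_pseudo_amenable_net_def)
    fix a
    have "net_tendsto D le
        (\<lambda>i. T2 (bidual_lmult tensor_lmult a (m i) - bidual_rmult tensor_rmult (m i) a)) (T2 0)"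
      using m by (intro net_tendsto_bounded_clinear[OF T2]) (simp add: strong_pseudo_amenable_net_def)
    then show "net_tendsto D le
        (\<lambda>i. T2 (bidual_lmult tensor_lmult a (m i)) - T2 (bidual_rmult tensor_rmult (m i) a)) 0"
      by (simp add: clinear_diff clinear_zero bounded_clinear_clinear[OF T2])
    show "net_tendsto D le
        (\<lambda>i. \<theta>2 (bidual_rmult (*) (dual_map (dual_map product_map) (m i)) a))
        (canonical_embedding (\<theta> a))"
      \<comment> \<open>The limit is rewritten as the image under \<open>\<theta>2\<close> of
        \<open>canonical_embedding a\<close>, so that continuity of \<open>\<theta>2\<close>
        applies.\<close>
      unfolding canonical_embedding_natural[OF \<theta>, symmetric] \<theta>2_def[symmetric]
      using m by (intro net_tendsto_bounded_clinear[OF \<theta>2]) (simp add: strong_pseudo_amenable_net_def)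
  next
    fix i a
    assume "i \<in> D"
    then show "\<theta>2 (bidual_lmult (*) a (dual_map (dual_map product_map) (m i))) =
        \<theta>2 (bidual_rmult (*) (dual_map (dual_map product_map) (m i)) a)"
      using m by (simp add: strong_pseudo_amenable_net_def)
  qed
  then show ?thesis
    by (rule strong_pseudo_amenable_if_net)
qed

end


section \<open>Corner entries and matrix units\<close>

lemma bounded_clinear_up_entry: "bounded_clinear (\<lambda>x. up_entry x i j)"
  by (rule bounded_clinearI[of _ 1])
    (simp_all add: plus_up.rep_eq scaleC_up.rep_eq norm_up_entry_le)

lemma infsum_single_support:
  "(\<And>k. k \<noteq> i \<Longrightarrow> f k = 0) \<Longrightarrow> (\<Sum>\<^sub>\<infinity>k. f k) = (f i :: 'a::{comm_monoid_add, t2_space})"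
  using infsum_cong_neutral[of UNIV "{i}" f f] by simp

text \<open>Column \<open>bot\<close> of an upper triangular matrix vanishes below its first entry,
  so only \<open>k = bot\<close> contributes. This makes the corner entry a homomorphism.\<close>

lemma up_entry_mult_bot:
  "up_entry (x * y) bot bot = up_entry x bot bot * up_entry y (bot::'i::{linorder, order_bot}) bot"
  unfolding times_up.rep_eq
  by (rule infsum_single_support) (simp add: up_entry_below bot.not_eq_extremum)

text \<open>The guard \<open>i \<le> j\<close> keeps the function total: positions below the
  diagonal yield the zero matrix.\<close>

lift_definition up_unit :: "'i::linorder \<Rightarrow> 'i \<Rightarrow> 'a::complex_banach_algebra \<Rightarrow> ('i, 'a) up"
  is "\<lambda>i j a k l. if k = i \<and> l = j \<and> i \<le> j then a else 0"
proof (intro conjI allI impI)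
  fix i j :: 'i and a :: 'a
  show "(\<lambda>(k, l). norm (if k = i \<and> l = j \<and> i \<le> j then a else 0)) summable_on UNIV"
    by (rule summable_on_cong_neutral[THEN iffD1, OF _ _ _ summable_on_finite[of "{(i, j)}"]])
      (auto split: if_splits)
qed auto

lemma norm_up_unit_le: "norm (up_unit i j a) \<le> norm a"
proof -
  have "norm (up_unit i j a) =
      (case (i, j) of (k, l) \<Rightarrow> norm (if k = i \<and> l = j \<and> i \<le> j then a else 0))"
    unfolding norm_up.rep_eq up_unit.rep_eq by (rule infsum_single_support) (auto split: if_splits)
  then show ?thesis
    by simp
qed

lemma bounded_clinear_up_unit: "bounded_clinear (up_unit i j)"
  by (rule bounded_clinearI[of _ 1])
    (auto intro!: up_eqI simp: plus_up.rep_eq scaleC_up.rep_eq up_unit.rep_eq norm_up_unit_le)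

lemma up_entry_mult_unit:
  assumes "i \<le> j"
  shows "up_entry (x * up_unit i j a) k j = up_entry x k i * a"
  unfolding times_up.rep_eq
  by (subst infsum_single_support[of i]) (simp_all add: up_unit.rep_eq assms)

lemma up_entry_unit_mult:
  assumes "i \<le> j"
  shows "up_entry (up_unit i j a * x) i k = a * up_entry x j k"
  unfolding times_up.rep_eq
  by (subst infsum_single_support[of j]) (simp_all add: up_unit.rep_eq assms)

lemma up_unit_mult: "up_unit i i (a * b) = up_unit i i a * up_unit i i b"
proof (rule up_eqI)
  fix k l
  show "up_entry (up_unit i i (a * b)) k l = up_entry (up_unit i i a * up_unit i i b) k l"
    unfolding times_up.rep_eq
    by (subst infsum_single_support[of i]) (auto simp: up_unit.rep_eq)
qed

lemma surj_up_entry: "surj (\<lambda>x. up_entry x i i)"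
  by (rule surjI[of _ "up_unit i i"]) (simp add: up_unit.rep_eq)

lemma surj_up_unit:
  assumes "(UNIV :: 'i set) = {i}"
  shows "surj (up_unit i (i::'i::linorder))"
proof (rule surjI[of _ "\<lambda>x. up_entry x i i"])
  fix x :: "('i, 'a) up"
  have "k = i" for k :: 'i
    using assms by auto
  then show "up_unit i i (up_entry x i i) = x"
    by (metis (mono_tags, lifting) order_refl up_eqI up_unit.rep_eq)
qed


section \<open>Strong pseudo-amenability of \<open>UP(I, A)\<close>\<close>

text \<open>Supplies the bilinear form that becomes the functional \<open>B\<close> separating the
  two module actions below.\<close>

lemma bounded_cbilinear_mult_functionals:
  assumes f: "bounded_clinear (f :: _ \<Rightarrow> complex)" and g: "bounded_clinear g"
  shows "bounded_cbilinear (\<lambda>x y. f x * g y)"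
proof -
  obtain K L where K: "K \<ge> 0" "\<And>x. norm (f x) \<le> norm x * K" and L: "\<And>y. norm (g y) \<le> norm y * L"
    using f g by (meson bounded_clinear_bound)
  show ?thesis
  proof (rule bounded_cbilinearI)
    fix x y
    have "norm (f x * g y) \<le> (norm x * K) * (norm y * L)"
      unfolding norm_mult using K L by (intro mult_mono) auto
    then show "norm (f x * g y) \<le> norm x * norm y * (K * L)"
      by (simp add: ac_simps)
  qed (use f g in \<open>simp_all add: bounded_clinear_def clinear_add clinear_scaleC scaleC_complex_def
        algebra_simps\<close>)
qed

lemma strong_pseudo_amenable_up_trivial_order:
  fixes \<phi> :: "'a::complex_banach_algebra \<Rightarrow> complex" and j :: "'i::{linorder, order_bot}"
  assumes \<phi>: "\<phi> \<in> characters" and spa: "strong_pseudo_amenable TYPE(('i, 'a) up)"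
  shows "j = bot"
proof (rule ccontr)
  assume j: "j \<noteq> bot"
  obtain D :: "((('i, 'a) up, ('i, 'a) up) ptensor cdual cdual \<times>
      (('i, 'a) up, ('i, 'a) up) ptensor cdual cdual set) set" and le
    and m :: "_ \<Rightarrow> (('i, 'a) up, ('i, 'a) up) ptensor cdual cdual"
    where m: "strong_pseudo_amenable_net D le m"
    using spa unfolding strong_pseudo_amenable_def by blast
  obtain c where c: "\<phi> c = 1"
    using character_eq_one[OF \<phi>] .
  define \<psi> \<xi> where "\<psi> = (\<lambda>x :: ('i, 'a) up. \<phi> (up_entry x bot bot))"
    and "\<xi> = (\<lambda>x :: ('i, 'a) up. \<phi> (up_entry x bot j))"
  define a b where "a = up_unit bot j c" and "b = up_unit (bot::'i) bot c"
  have \<psi>: "bounded_clinear \<psi>" and \<xi>: "bounded_clinear \<xi>"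
    unfolding \<psi>_def \<xi>_def
    by (intro bounded_clinear_compose[OF bounded_clinear_character[OF \<phi>] bounded_clinear_up_entry])+
  have \<psi>_mult: "\<psi> (x * y) = \<psi> x * \<psi> y" for x y
    by (simp add: \<psi>_def up_entry_mult_bot character_mult[OF \<phi>])
  have \<psi>_b: "\<psi> b = 1"
    by (simp add: \<psi>_def b_def up_unit.rep_eq c)
  have \<psi>_a: "\<psi> (a * x) = 0" for x
    \<comment> \<open>The corner of \<open>a * x\<close> is \<open>c\<close> times the entry of
      \<open>x\<close> at \<open>(j, bot)\<close>, which lies strictly below the diagonal.\<close>
    using j by (simp add: \<psi>_def a_def up_entry_unit_mult up_entry_below bot.not_eq_extremum
        clinear_zero[OF character_clinear[OF \<phi>]])
  have \<xi>_a: "\<xi> (x * a) = \<psi> x" for x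
    by (simp add: \<psi>_def \<xi>_def a_def up_entry_mult_unit character_mult[OF \<phi>] c)
  define B where "B = ptensor_lift (\<lambda>x y. \<psi> x * \<xi> y)"
  have B: "bounded_clinear B" and B_of: "B (x \<otimes>\<^sub>p y) = \<psi> x * \<xi> y" for x y
    unfolding B_def using bounded_cbilinear_mult_functionals[OF \<psi> \<xi>]
    by (rule bounded_clinear_ptensor_lift, rule ptensor_lift_of)
  define B' \<psi>' where "B' = Abs_cdual B" and "\<psi>' = Abs_cdual \<psi>"
  have B': "cdual_apply B' = B" and \<psi>': "cdual_apply \<psi>' = \<psi>"
    using B \<psi> by (simp_all add: B'_def \<psi>'_def Abs_cdual_inverse)
  have lB: "dual_map (tensor_lmult a) B' = 0"
  proof (rule cdual_eqI)
    have "(\<lambda>t. B (tensor_lmult a t)) = (\<lambda>t. 0)"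
      by (rule ptensor_ext)
        (simp_all add: bounded_clinear_compose B bounded_clinear_tensor_lmult bounded_clinear_zero
          tensor_lmult_of B_of \<psi>_a)
    then show "cdual_apply (dual_map (tensor_lmult a) B') t = cdual_apply 0 t" for t
      by (simp add: cdual_apply_dual_map bounded_clinear_tensor_lmult B' zero_cdual.rep_eq fun_eq_iff)
  qed
  have rB: "dual_map (\<lambda>t. tensor_rmult t a) B' = dual_map product_map \<psi>'"
  proof (rule cdual_eqI)
    have "(\<lambda>t. B (tensor_rmult t a)) = (\<lambda>t. \<psi> (product_map t))"
      by (rule ptensor_ext)
        (simp_all add: bounded_clinear_compose[OF B bounded_clinear_tensor_rmult]
          bounded_clinear_compose[OF \<psi> bounded_clinear_product_map]
          tensor_rmult_of product_map_of B_of \<xi>_a \<psi>_mult)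
    then show "cdual_apply (dual_map (\<lambda>t. tensor_rmult t a) B') t =
        cdual_apply (dual_map product_map \<psi>') t" for t
      by (simp add: cdual_apply_dual_map bounded_clinear_tensor_rmult bounded_clinear_product_map
          B' \<psi>' fun_eq_iff)
  qed
  \<comment> \<open>As \<open>\<psi> b = 1\<close>, right multiplication by \<open>b\<close> fixes
    the functional \<open>\<psi>'\<close>; the approximate identity condition at \<open>b\<close>
    then speaks about \<open>v\<close> itself.\<close>
  have r\<psi>: "dual_map (\<lambda>x. x * b) \<psi>' = \<psi>'"
    by (rule cdual_eqI)
      (simp add: cdual_apply_dual_map bounded_clinear_times_right \<psi>' \<psi>_mult \<psi>_b)
  define v where "v = (\<lambda>i. cdual_apply (dual_map (dual_map product_map) (m i)) \<psi>')"
  have "net_tendsto D le (\<lambda>i. cdual_apply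
      (bidual_lmult tensor_lmult a (m i) - bidual_rmult tensor_rmult (m i) a) B') (cdual_apply 0 B')"
    using m by (intro net_tendsto_bounded_clinear[OF bounded_clinear_apply])
      (simp add: strong_pseudo_amenable_net_def)
  \<comment> \<open>The left action contributes 0 by \<open>lB\<close>; by \<open>rB\<close> the
    right action contributes \<open>v i\<close>.\<close>
  moreover have "cdual_apply
      (bidual_lmult tensor_lmult a (m i) - bidual_rmult tensor_rmult (m i) a) B' = - v i" for i
    by (simp add: clinear_diff[OF bounded_clinear_clinear[OF bounded_clinear_apply]]
        cdual_apply_bidual_lmult cdual_apply_bidual_rmult bounded_clinear_tensor_lmult
        bounded_clinear_tensor_rmult lB rB v_def cdual_apply_dual_map bounded_clinear_dual_map
        bounded_clinear_product_map clinear_zero[OF bounded_clinear_clinear[OF bounded_clinear_cdual_apply]])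
  ultimately have v0: "net_tendsto D le (\<lambda>i. - v i) 0"
    by (simp add: zero_cdual.rep_eq)
  have "net_tendsto D le (\<lambda>i. cdual_apply
      (bidual_rmult (*) (dual_map (dual_map product_map) (m i)) b) \<psi>')
      (cdual_apply (canonical_embedding b) \<psi>')"
    using m by (intro net_tendsto_bounded_clinear[OF bounded_clinear_apply])
      (simp add: strong_pseudo_amenable_net_def)
  then have v1: "net_tendsto D le v 1"
    by (simp add: cdual_apply_bidual_rmult bounded_clinear_times_right r\<psi> v_def
        canonical_embedding.rep_eq \<psi>' \<psi>_b)
  \<comment> \<open>The open discs of radius 1/2 about 0 and 1 are disjoint, while directedness
    provides an index whose value lies in both.\<close>
  have half: "(1 / 2 :: real) > 0"
    by simp
  obtain i1 where i1: "i1 \<in> D" "\<And>i. i \<in> D \<Longrightarrow> le i1 i \<Longrightarrow> norm (- v i - 0) < 1 / 2"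
    using v0 half unfolding net_tendsto_def by blast
  obtain i2 where i2: "i2 \<in> D" "\<And>i. i \<in> D \<Longrightarrow> le i2 i \<Longrightarrow> norm (v i - 1) < 1 / 2"
    using v1 half unfolding net_tendsto_def by blast
  obtain i where i: "i \<in> D" "le i1 i" "le i2 i"
    using m i1(1) i2(1) unfolding strong_pseudo_amenable_net_def directed_set_def by blast
  have "norm (v i) < 1 / 2" "norm (v i - 1) < 1 / 2"
    using i1(2)[OF i(1,2)] i2(2)[OF i(1,3)] by simp_all
  then show False
    using norm_triangle_ineq4[of "v i" "v i - 1"] by simp
qed

theorem theorem3p1:
  fixes \<phi> :: "'a::complex_banach_algebra \<Rightarrow> complex"
  assumes "\<phi> \<in> characters"
  shows "strong_pseudo_amenable TYPE(('i::{linorder, order_bot}, 'a) up) \<longleftrightarrow>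
    strong_pseudo_amenable TYPE('a) \<and> card (UNIV :: 'i set) = 1"
proof (intro iffI conjI; (elim conjE)?)
  assume spa: "strong_pseudo_amenable TYPE(('i, 'a) up)"
  show "strong_pseudo_amenable TYPE('a)"
    by (rule strong_pseudo_amenable_image[OF bounded_clinear_up_entry up_entry_mult_bot surj_up_entry spa])
  have "(UNIV :: 'i set) = {bot}"
    using strong_pseudo_amenable_up_trivial_order[OF assms spa] by blast
  then show "card (UNIV :: 'i set) = 1"
    by (metis card_1_singleton_iff One_nat_def)
next
  assume spa: "strong_pseudo_amenable TYPE('a)" and "card (UNIV :: 'i set) = 1"
  \<comment> \<open>Infinite sets have \<open>card\<close> equal to 0, so cardinality 1 really means
    a single index.\<close>
  then have "(UNIV :: 'i set) = {bot}"
    by (metis UNIV_I card_1_singletonE singletonD)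
  then show "strong_pseudo_amenable TYPE(('i, 'a) up)"
    by (intro strong_pseudo_amenable_image[OF bounded_clinear_up_unit up_unit_mult surj_up_unit spa])
qed

end
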